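(* Let $\mu_1,\mu_2$ be two nondegenerate critical offspring distributions with finite second moment. Then there is a constant $C=C(\mu_1,\mu_2)>0$, depending only on $\mu_1,\mu_2$ (in particular independent of $\theta$), such that for every jump distribution $\theta$ on $\mathbb Z^d$ as in the context and every finite subset $A\subset\mathbb Z^d$, $$C^{-1}\cdot\mathrm{BCap}_{\mu_1,\theta}(A)\le\mathrm{BCap}_{\mu_2,\theta}(A)\le C\cdot\mathrm{BCap}_{\mu_1,\theta}(A).$$
   Context: Setting. $d\ge5$. A critical offspring distribution is a probability distribution on $\mathbb N=\{0,1,2,\dots\}$ with mean $1$; nondegenerate means it is not the point mass at $1$. A jump distribution $\theta$ is a probability distribution on $\mathbb Z^d$ with mean zero, not supported on a strict subgroup of $\mathbb Z^d$, such that for some constant $C_\theta>0$, $\theta(\{x:|x|>r\})<C_\theta r^{-d}$ for all $r\ge1$ ($|\cdot|$ is the Euclidean norm). Branching capacity for given offspring distribution $\mu$ (nondegenerate, critical, finite second moment) and jump distribution $\theta$. Trees are rooted ordered (plane) trees. Let $\tilde\mu(i)=\sum_{j\ge i+1}\mu(j)$, a probability measure on $\mathbb N$. The adjoint $\mu$-GW tree is the Galton–Watson tree in which the root has offspring law $\tilde\mu$ and all other vertices have offspring law $\mu$. The infinite $\mu$-GW tree: take a semi-infinite line of vertices (the spine), rooted at its first vertex, and graft to the left of each spine vertex (identifying roots) an independent adjoint $\mu$-GW tree, called a bush. The reversed infinite snake from $x\in\mathbb Z^d$: $T$ is an infinite $\mu$-GW tree; conditionally on $T$, independent variables are assigned to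 its edges, with law $\theta^-(z)=\theta(-z)$ on spine edges and $\theta$ on all other edges; $\mathcal S_T(v)-x$ is the sum of the variables on the simple path from the root to $v$; it visits $A$ at $v$ if $\mathcal S_T(v)\in A$. $\mathrm{Es}_A(x)$ is the probability that a reversed infinite snake from $x$ does not visit $A$ except possibly by the image of the bush grafted to the root (the bush includes the root). Then $\mathrm{BCap}_{\mu,\theta}(A)=\sum_{z\in A}\mathrm{Es}_A(z)$. *)

theory Defs
  imports "HOL-Probability.Probability"
begin

section \<open>Offspring and jump distributions\<close>

definition critical :: "nat pmf \<Rightarrow> bool" where
  "critical \<mu> \<longleftrightarrow> integrable (measure_pmf \<mu>) real \<and> measure_pmf.expectation \<mu> real = 1"

definition nondegenerate :: "nat pmf \<Rightarrow> bool" where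
  "nondegenerate \<mu> \<longleftrightarrow> \<mu> \<noteq> return_pmf 1"

definition finite_second_moment :: "nat pmf \<Rightarrow> bool" where
  "finite_second_moment \<mu> \<longleftrightarrow> integrable (measure_pmf \<mu>) (\<lambda>n. (real n)\<^sup>2)"

definition euclidean_norm :: "int ^ 'd::finite \<Rightarrow> real" where
  "euclidean_norm x = norm (\<chi> i. real_of_int (x $ i))"

definition additive_subgroup :: "'a::ab_group_add set \<Rightarrow> bool" where
  "additive_subgroup H \<longleftrightarrow>
     0 \<in> H \<and> (\<forall>x\<in>H. \<forall>y\<in>H. x + y \<in> H) \<and> (\<forall>x\<in>H. - x \<in> H)"

definition mean_zero :: "(int ^ 'd::finite) pmf \<Rightarrow> bool" where
  "mean_zero \<theta> \<longleftrightarrow>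
     (\<forall>i. integrable (measure_pmf \<theta>) (\<lambda>x. real_of_int (x $ i)) \<and>
          measure_pmf.expectation \<theta> (\<lambda>x. real_of_int (x $ i)) = 0)"

definition jump_distribution :: "(int ^ 'd::finite) pmf \<Rightarrow> bool" where
  "jump_distribution \<theta> \<longleftrightarrow>
     mean_zero \<theta> \<and>
     \<not> (\<exists>H. additive_subgroup H \<and> H \<noteq> UNIV \<and> set_pmf \<theta> \<subseteq> H) \<and>
     (\<exists>C>0. \<forall>r::real. r \<ge> 1 \<longrightarrow>
        measure_pmf.prob \<theta> {x. euclidean_norm x > r} < C * r powr (- real CARD('d)))"

text \<open>
  The measure \<open>\<mu>\<close>-tilde. The function given to \<^const>\<open>embed_pmf\<close> sums to the mean of \<open>\<mu>\<close>,
  so this is meaningful only for critical \<open>\<mu>\<close>; see \<open>pmf_adjoint\<close> below.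
\<close>

definition adjoint_pmf :: "nat pmf \<Rightarrow> nat pmf" where
  "adjoint_pmf \<mu> = embed_pmf (\<lambda>i. measure_pmf.prob \<mu> {Suc i..})"

lemma pmf_adjoint:
  assumes "critical \<mu>"
  shows "pmf (adjoint_pmf \<mu>) i = measure_pmf.prob \<mu> {Suc i..}"
proof -
  have "(\<integral>\<^sup>+i. ennreal (measure_pmf.prob \<mu> {Suc i..}) \<partial>count_space UNIV)
      = (\<Sum>i. emeasure (measure_pmf \<mu>) {x\<in>space (measure_pmf \<mu>). i < x})"
    by (simp add: nn_integral_count_space_nat measure_pmf.emeasure_eq_measure
        atLeast_def Suc_le_eq)
  also have "\<dots> = (\<integral>\<^sup>+x. of_nat x \<partial>measure_pmf \<mu>)"
    by (rule nn_integral_nat_function [symmetric]) simp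
  also have "\<dots> = (\<integral>\<^sup>+x. ennreal (real x) \<partial>measure_pmf \<mu>)"
    by (simp add: ennreal_of_nat_eq_real_of_nat)
  also have "\<dots> = 1"
    using assms unfolding critical_def by (subst nn_integral_eq_integral) auto
  finally show ?thesis
    unfolding adjoint_pmf_def by (subst pmf_embed_pmf) auto
qed

lemma pmf_adjoint_sums:
  assumes "critical \<mu>"
  shows "(\<lambda>k. pmf \<mu> (Suc i + k)) sums pmf (adjoint_pmf \<mu>) i"
proof -
  have "(\<lambda>k. measure_pmf.prob \<mu> {Suc i + k}) sums measure_pmf.prob \<mu> (\<Union>k. {Suc i + k})"
    by (rule measure_pmf.finite_measure_UNION) (auto simp: disjoint_family_on_def)
  moreover have "(\<Union>k. {Suc i + k}) = {Suc i..}"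
    by (auto simp: le_iff_add)
  ultimately show ?thesis
    using pmf_adjoint [OF assms] by (simp add: measure_pmf_single)
qed

section \<open>Galton--Watson trees\<close>

text \<open>
  Plane trees in Ulam--Harris--Neveu notation: a vertex of a bush is the list of birth ranks on the path
  from the root of the bush, and \<open>N w\<close> is the number of children of \<open>w\<close>. The values of \<open>N\<close> outside
  the tree are irrelevant.
\<close>

definition plane_tree :: "(nat list \<Rightarrow> nat) \<Rightarrow> nat list set" where
  "plane_tree N = {w. \<forall>k<length w. w ! k < N (take k w)}"

text \<open>
  A vertex \<open>(n, w)\<close> of the infinite tree is the vertex \<open>w\<close> of the bush grafted to the \<open>n\<close>-th spine
  vertex. That spine vertex is \<open>(n, [])\<close>, which is also the root of the bush, and \<open>(0, [])\<close> is the
  root of the infinite tree. The child \<open>(n + 1, [])\<close> of \<open>(n, [])\<close> is understood to lie to the right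
  of its children \<open>(n, [i])\<close>.
\<close>

type_synonym vertex = "nat \<times> nat list"

definition bush :: "(vertex \<Rightarrow> nat) \<Rightarrow> nat \<Rightarrow> vertex set" where
  "bush N n = {n} \<times> plane_tree (\<lambda>w. N (n, w))"

definition infinite_tree :: "(vertex \<Rightarrow> nat) \<Rightarrow> vertex set" where
  "infinite_tree N = (\<Union>n. bush N n)"

text \<open>
  \<open>N (n, w)\<close> counts the children of \<open>(n, w)\<close> within its bush, so a spine vertex has
  \<open>N (n, []) + 1\<close> children in all.
\<close>

definition infinite_GW :: "nat pmf \<Rightarrow> (vertex \<Rightarrow> nat) measure" where
  "infinite_GW \<mu> =
     PiM UNIV (\<lambda>(n, w). measure_pmf (if w = [] then adjoint_pmf \<mu> else \<mu>))"

section \<open>The reversed infinite snake and branching capacity\<close>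

text \<open>
  An edge is indexed by its endpoint farther from the root, so the spine edges are the \<open>(n, [])\<close>
  with \<open>n \<ge> 1\<close>; the variable at \<open>(0, [])\<close> is never used. Variables are assigned to all potential
  edges, independently of the offspring numbers. Those on the edges of the tree are then, given
  the tree, independent with the prescribed laws.
\<close>

definition edge_variables ::
  "(int ^ 'd::finite) pmf \<Rightarrow> (vertex \<Rightarrow> int ^ 'd) measure" where
  "edge_variables \<theta> =
     PiM UNIV (\<lambda>(n, w). measure_pmf (if w = [] then map_pmf uminus \<theta> else \<theta>))"

definition reversed_snake ::
  "nat pmf \<Rightarrow> (int ^ 'd::finite) pmf \<Rightarrow> ((vertex \<Rightarrow> nat) \<times> (vertex \<Rightarrow> int ^ 'd)) measure" where
  "reversed_snake \<mu> \<theta> = infinite_GW \<mu> \<Otimes>\<^sub>M edge_variables \<theta>"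

definition position :: "int ^ 'd::finite \<Rightarrow> (vertex \<Rightarrow> int ^ 'd) \<Rightarrow> vertex \<Rightarrow> int ^ 'd" where
  "position x X = (\<lambda>(n, w).
     x + (\<Sum>k=1..n. X (k, [])) + (\<Sum>k=1..length w. X (n, take k w)))"

definition Es ::
  "nat pmf \<Rightarrow> (int ^ 'd::finite) pmf \<Rightarrow> (int ^ 'd) set \<Rightarrow> int ^ 'd \<Rightarrow> real" where
  "Es \<mu> \<theta> A x =
     \<P>((N, X) in reversed_snake \<mu> \<theta>.
         \<forall>v \<in> infinite_tree N - bush N 0. position x X v \<notin> A)"

definition BCap :: "nat pmf \<Rightarrow> (int ^ 'd::finite) pmf \<Rightarrow> (int ^ 'd) set \<Rightarrow> real" where
  "BCap \<mu> \<theta> A = (\<Sum>z\<in>A. Es \<mu> \<theta> A z)"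

end

theory Submission
  imports Defs
begin

text \<open>
  Let \<open>q n x\<close> be the probability that the snake from \<open>x\<close> on a critical \<open>\<mu>\<close>-Galton--Watson tree hits
  \<open>A\<close> within \<open>n\<close> generations, and let \<open>P\<close> be the transition operator of the walk. Outside \<open>A\<close>, with
  \<open>s = P (q n) x\<close>, branching at the root gives \<open>q (n + 1) x = s - h s\<close>, where \<open>h s\<close> is the defect
  \<open>f (1 - s) - (1 - s)\<close> of the generating function \<open>f\<close> of \<open>\<mu>\<close>. Two ideas turn this recursion into a
  comparison of capacities.

  Comparison. Criticality, nondegeneracy and the second moment give \<open>a s\<^sup>2 \<le> h s \<le> b s\<^sup>2\<close> on \<open>[0, 1]\<close>
  with \<open>0 < a\<close>. Since \<open>h\<close> is quadratic while the rest of the recursion is linear, for a large \<open>K\<close>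
  that depends only on \<open>\<mu>1\<close> and \<open>\<mu>2\<close> the multiple \<open>K q\<^sub>1\<close> of the solution for \<open>\<mu>1\<close> is a supersolution
  of the recursion for \<open>\<mu>2\<close>. Hence \<open>q\<^sub>2 n x \<le> K q\<^sub>1 n x\<close> for all \<open>n\<close>, \<open>x\<close>, \<open>A\<close> and \<open>\<theta>\<close>
  (\<open>gen_fun_comparison\<close>, \<open>hit_comparison\<close>).

  Capacity as a growth rate. The generating function of the adjoint offspring law is
  \<open>(1 - f t) / (1 - t)\<close>, so \<open>s - h s\<close> is \<open>s\<close> times the probability that a bush rooted at \<open>x\<close>,
  suitably truncated, misses \<open>A\<close> (\<open>hit_Suc_bush\<close>). Thus \<open>q\<close> counts paths of a killed walk that end
  in \<open>A\<close>. Sum over the starting point \<open>x\<close> and reverse time: the paths become those of the reversed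
  walk started in \<open>A\<close>, killed when a bush along the way hits \<open>A\<close>. A path of length \<open>k\<close> therefore
  contributes the probability that the bushes at times \<open>1, ..., k\<close> of the spine miss \<open>A\<close>, up to the
  truncation of their heights, and these probabilities decrease to the escape probabilities. So the
  sum of \<open>q n x\<close> over all \<open>x\<close> is at least \<open>n + 1\<close> times the capacity and is \<open>n\<close> times the capacity
  to leading order (\<open>hit_mass_ge\<close>, \<open>hit_mass_le\<close>). Summing \<open>q\<^sub>2 \<le> K q\<^sub>1\<close> over \<open>x\<close> and dividing by \<open>n\<close>
  compares the capacities (\<open>escape_sum_comparison\<close>).

  The probabilistic input is that these recursions describe the snake. The offspring numbers and
  edge variables of disjoint sets of vertices are independent (\<open>prob_disjoint_regions\<close>), so
  conditioning on the values at one vertex (\<open>emeasure_resample\<close>) reproduces each recursion step, and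
  continuity from above removes the truncation (\<open>spine_miss_tendsto_Es\<close>).
\<close>

section \<open>Generating functions of critical offspring distributions\<close>

lemma integrable_pmf_unit:
  fixes f :: "'a \<Rightarrow> real"
  assumes "\<And>x. x \<in> set_pmf p \<Longrightarrow> 0 \<le> f x \<and> f x \<le> 1"
  shows "integrable (measure_pmf p) f"
  using assms by (intro measure_pmf.integrable_const_bound[where B = 1]) (auto simp: AE_measure_pmf_iff)

lemma expectation_pmf_unit:
  fixes f :: "'a \<Rightarrow> real"
  assumes "\<And>x. 0 \<le> f x \<and> f x \<le> 1"
  shows "0 \<le> measure_pmf.expectation p f" "measure_pmf.expectation p f \<le> 1"
proof -
  show "0 \<le> measure_pmf.expectation p f"
    using assms by (simp add: integral_nonneg)
  have "measure_pmf.expectation p f \<le> measure_pmf.expectation p (\<lambda>_. 1)"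
    using assms by (intro integral_mono integrable_pmf_unit) auto
  then show "measure_pmf.expectation p f \<le> 1" by simp
qed

definition gen_fun :: "nat pmf \<Rightarrow> real \<Rightarrow> real" where
  "gen_fun \<mu> s = measure_pmf.expectation \<mu> (\<lambda>j. s ^ j)"

text \<open>
  The transition operator of the random walk with step law \<open>\<theta>\<close>. For \<open>map_pmf uminus \<theta>\<close> it is the
  operator of the reversed walk, which is the adjoint of the former with respect to counting
  measure.
\<close>
definition jump_mean :: "'a::ab_group_add pmf \<Rightarrow> ('a \<Rightarrow> real) \<Rightarrow> 'a \<Rightarrow> real" where
  "jump_mean \<theta> u x = measure_pmf.expectation \<theta> (\<lambda>z. u (x + z))"

lemma gen_fun_unit:
  assumes "0 \<le> s" "s \<le> 1"
  shows "0 \<le> gen_fun \<mu> s" "gen_fun \<mu> s \<le> 1"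
  using assms unfolding gen_fun_def by (intro expectation_pmf_unit; simp add: power_le_one)+

lemma gen_fun_mono:
  assumes "0 \<le> s" "s \<le> t" "t \<le> 1"
  shows "gen_fun \<mu> s \<le> gen_fun \<mu> t"
  using assms unfolding gen_fun_def
  by (intro integral_mono integrable_pmf_unit power_mono) (auto simp: power_le_one)

lemma gen_fun_sums:
  assumes "0 \<le> s" "s \<le> 1"
  shows "(\<lambda>j. pmf \<mu> j * s ^ j) sums gen_fun \<mu> s"
proof -
  have "integrable (count_space UNIV) (\<lambda>j. pmf \<mu> j *\<^sub>R s ^ j)"
    using integrable_pmf_unit[of \<mu> "\<lambda>j. s ^ j"] assms
    by (simp add: measure_pmf_eq_density integrable_density power_le_one)
  then have "(\<lambda>j. pmf \<mu> j *\<^sub>R s ^ j) sums (\<integral>j. pmf \<mu> j *\<^sub>R s ^ j \<partial>count_space UNIV)"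
    by (rule sums_integral_count_space_nat)
  moreover have "gen_fun \<mu> s = (\<integral>j. pmf \<mu> j *\<^sub>R s ^ j \<partial>count_space UNIV)"
    unfolding gen_fun_def measure_pmf_eq_density by (subst integral_density) auto
  ultimately show ?thesis by simp
qed

text \<open>
  The weights of \<open>adjoint_pmf \<mu>\<close> are tails of \<open>\<mu>\<close>, so consecutive weights differ by a weight of \<open>\<mu>\<close>
  and multiplication by \<open>1 - s\<close> telescopes. This identity is why the adjoint tree belongs in the
  capacity: it turns the nonlinear recursion for hitting probabilities into a linear one with
  killing (\<open>hit_Suc_bush\<close> below).
\<close>
lemma gen_fun_adjoint:
  assumes "critical \<mu>" "0 \<le> s" "s \<le> 1"
  shows "gen_fun (adjoint_pmf \<mu>) s * (1 - s) = 1 - gen_fun \<mu> s"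
proof -
  let ?a = "\<lambda>i. pmf (adjoint_pmf \<mu>) i"
  have a: "?a i = measure_pmf.prob \<mu> {Suc i..}" for i
    by (rule pmf_adjoint[OF assms(1)])
  have step: "?a i - ?a (Suc i) = pmf \<mu> (Suc i)" for i
  proof -
    have "{Suc i..} = insert (Suc i) {Suc (Suc i)..}" by auto
    moreover have "measure_pmf.prob \<mu> ({Suc i} \<union> {Suc (Suc i)..})
        = measure_pmf.prob \<mu> {Suc i} + measure_pmf.prob \<mu> {Suc (Suc i)..}"
      by (rule measure_pmf.finite_measure_Union) auto
    ultimately have "measure_pmf.prob \<mu> {Suc i..} = pmf \<mu> (Suc i) + measure_pmf.prob \<mu> {Suc (Suc i)..}"
      by (simp add: measure_pmf_single)
    then show ?thesis by (simp add: a)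
  qed
  have zero: "?a 0 = 1 - pmf \<mu> 0"
  proof -
    have "{Suc 0..} = UNIV - {0}" by auto
    then show ?thesis
      using measure_pmf.prob_compl[of "{0}" \<mu>] by (simp add: a measure_pmf_single)
  qed
  have A: "(\<lambda>i. ?a i * s ^ i) sums gen_fun (adjoint_pmf \<mu>) s"
    using assms by (intro gen_fun_sums)
  have B: "(\<lambda>i. ?a i * s ^ Suc i) sums (s * gen_fun (adjoint_pmf \<mu>) s)"
    using sums_mult[OF A, of s] by (simp add: mult_ac)
  have C: "(\<lambda>i. ?a (Suc i) * s ^ Suc i) sums (gen_fun (adjoint_pmf \<mu>) s - ?a 0)"
    using A by (subst sums_Suc_iff) simp
  have D: "(\<lambda>i. pmf \<mu> (Suc i) * s ^ Suc i) sums (gen_fun \<mu> s - pmf \<mu> 0)"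
    using gen_fun_sums[of s \<mu>] assms by (subst sums_Suc_iff) simp
  have "(\<lambda>i. ?a i * s ^ Suc i - ?a (Suc i) * s ^ Suc i)
      sums (s * gen_fun (adjoint_pmf \<mu>) s - (gen_fun (adjoint_pmf \<mu>) s - ?a 0))"
    by (rule sums_diff[OF B C])
  then have "(\<lambda>i. pmf \<mu> (Suc i) * s ^ Suc i)
      sums (s * gen_fun (adjoint_pmf \<mu>) s - (gen_fun (adjoint_pmf \<mu>) s - ?a 0))"
    by (simp only: left_diff_distrib[symmetric] step)
  with D have "gen_fun \<mu> s - pmf \<mu> 0 = s * gen_fun (adjoint_pmf \<mu>) s - (gen_fun (adjoint_pmf \<mu>) s - ?a 0)"
    by (rule sums_unique2)
  then show ?thesis by (simp add: zero algebra_simps)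
qed

text \<open>
  For \<open>j = 2\<close> there is equality, and the right-hand side increases with \<open>j\<close>.
\<close>
lemma power_defect_ge:
  fixes s :: real
  assumes "0 \<le> s" "s \<le> 1" "2 \<le> j"
  shows "s\<^sup>2 \<le> (1 - s) ^ j - 1 + real j * s"
  using assms(3)
proof (induction j rule: dec_induct)
  case base
  show ?case by (simp add: power2_eq_square algebra_simps)
next
  case (step j)
  have "0 \<le> s * (1 - (1 - s) ^ j)"
    using assms by (intro mult_nonneg_nonneg) (auto simp: power_le_one)
  with step show ?case by (simp add: algebra_simps)
qed

lemma power_defect_le:
  fixes s :: real
  assumes "0 \<le> s" "s \<le> 1"
  shows "(1 - s) ^ j - 1 + real j * s \<le> (real j)\<^sup>2 * s\<^sup>2"
proof (induction j)
  case (Suc j)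
  have "1 - real j * s \<le> (1 - s) ^ j"
    using Bernoulli_inequality[of "- s" j] assms by simp
  then have "s * (1 - (1 - s) ^ j) \<le> s * (real j * s)"
    using assms by (intro mult_left_mono) auto
  then have "(1 - s) ^ Suc j - 1 + real (Suc j) * s \<le> (real j)\<^sup>2 * s\<^sup>2 + real j * s\<^sup>2"
    using Suc by (simp add: algebra_simps power2_eq_square)
  also have "\<dots> \<le> (real (Suc j))\<^sup>2 * s\<^sup>2"
    using assms by (simp add: power2_eq_square algebra_simps)
  finally show ?case .
qed simp

text \<open>
  Criticality cancels the linear term of \<open>gen_fun \<mu> (1 - s) - 1\<close> at \<open>s = 0\<close>. What remains is an
  average of nonnegative quantities, each of order \<open>s\<^sup>2\<close> unless \<open>j\<close> is \<open>0\<close> or \<open>1\<close>. The second moment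
  bounds it from above, and the chance of having at least two children from below.
\<close>
lemma gen_fun_defect:
  assumes "critical \<mu>" "0 \<le> s" "s \<le> 1"
  shows "gen_fun \<mu> (1 - s) - 1 + s
      = measure_pmf.expectation \<mu> (\<lambda>j. (1 - s) ^ j - 1 + real j * s)"
    "integrable (measure_pmf \<mu>) (\<lambda>j. (1 - s) ^ j - 1 + real j * s)"
proof -
  have [simp]: "integrable (measure_pmf \<mu>) (\<lambda>j. (1 - s) ^ j)"
    using assms by (intro integrable_pmf_unit) (auto simp: power_le_one)
  have [simp]: "integrable (measure_pmf \<mu>) real" "measure_pmf.expectation \<mu> real = 1"
    using assms by (auto simp: critical_def)
  show "gen_fun \<mu> (1 - s) - 1 + s
      = measure_pmf.expectation \<mu> (\<lambda>j. (1 - s) ^ j - 1 + real j * s)"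
    by (simp add: gen_fun_def)
  show "integrable (measure_pmf \<mu>) (\<lambda>j. (1 - s) ^ j - 1 + real j * s)"
    by simp
qed

lemma gen_fun_defect_le:
  assumes "critical \<mu>" "finite_second_moment \<mu>"
  obtains c where "0 < c" "\<And>s. 0 \<le> s \<Longrightarrow> s \<le> 1 \<Longrightarrow> gen_fun \<mu> (1 - s) - 1 + s \<le> c * s\<^sup>2"
proof
  let ?m = "measure_pmf.expectation \<mu> (\<lambda>n. (real n)\<^sup>2)"
  show "0 < 1 + ?m" by (simp add: add_pos_nonneg integral_nonneg)
  fix s :: real assume s: "0 \<le> s" "s \<le> 1"
  have I: "integrable (measure_pmf \<mu>) (\<lambda>n. (real n)\<^sup>2)"
    using assms by (simp add: finite_second_moment_def)
  have "gen_fun \<mu> (1 - s) - 1 + s \<le> measure_pmf.expectation \<mu> (\<lambda>j. (real j)\<^sup>2 * s\<^sup>2)"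
    unfolding gen_fun_defect(1)[OF assms(1) s]
    using s assms I by (intro integral_mono gen_fun_defect(2) power_defect_le) auto
  also have "\<dots> = ?m * s\<^sup>2" by simp
  also have "\<dots> \<le> (1 + ?m) * s\<^sup>2" by (simp add: mult_right_mono)
  finally show "gen_fun \<mu> (1 - s) - 1 + s \<le> (1 + ?m) * s\<^sup>2" .
qed

lemma critical_two_children:
  assumes "critical \<mu>" "nondegenerate \<mu>"
  obtains j where "2 \<le> j" "0 < pmf \<mu> j"
proof -
  have "\<exists>j\<ge>2. pmf \<mu> j \<noteq> 0"
  proof (rule ccontr)
    assume "\<not> (\<exists>j\<ge>2. pmf \<mu> j \<noteq> 0)"
    then have sub: "set_pmf \<mu> \<subseteq> {0, 1}"
    proof (intro subsetI)
      fix j assume "j \<in> set_pmf \<mu>"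
      then have "\<not> 2 \<le> j" using \<open>\<not> (\<exists>j\<ge>2. pmf \<mu> j \<noteq> 0)\<close> by (auto simp: set_pmf_iff)
      then show "j \<in> {0, 1}" by auto
    qed
    have "measure_pmf.expectation \<mu> real = (\<Sum>j\<in>{0,1}. pmf \<mu> j *\<^sub>R real j)"
      by (rule integral_measure_pmf) (use sub in auto)
    then have "pmf \<mu> 1 = 1" using assms by (simp add: critical_def)
    moreover have "(\<Sum>j\<in>{0,1}. pmf \<mu> j) = 1"
      using sub by (intro sum_pmf_eq_1) auto
    ultimately have "pmf \<mu> 0 = 0" by simp
    then have "set_pmf \<mu> \<subseteq> {1}" using sub by (auto simp: set_pmf_iff)
    then show False using assms by (simp add: nondegenerate_def set_pmf_subset_singleton)
  qed
  then show ?thesis using that pmf_nonneg[of \<mu>] by (auto simp: less_le)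
qed

lemma gen_fun_defect_ge:
  assumes "critical \<mu>" "nondegenerate \<mu>"
  obtains c where "0 < c" "\<And>s. 0 \<le> s \<Longrightarrow> s \<le> 1 \<Longrightarrow> c * s\<^sup>2 \<le> gen_fun \<mu> (1 - s) - 1 + s"
proof -
  obtain j where j: "2 \<le> j" "0 < pmf \<mu> j"
    using critical_two_children[OF assms] .
  show ?thesis
  proof
    show "0 < pmf \<mu> j" by fact
    fix s :: real assume s: "0 \<le> s" "s \<le> 1"
    have nn: "0 \<le> (1 - s) ^ i - 1 + real i * s" for i
      using Bernoulli_inequality[of "- s" i] s by simp
    have "pmf \<mu> j * s\<^sup>2 = measure_pmf.expectation \<mu> (\<lambda>i. indicator {j} i * s\<^sup>2)"
      by (simp add: measure_pmf_single)
    also have "\<dots> \<le> measure_pmf.expectation \<mu> (\<lambda>i. (1 - s) ^ i - 1 + real i * s)"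
      using s assms j nn
      by (intro integral_mono gen_fun_defect(2) integrable_pmf_unit)
        (auto simp: indicator_def power_defect_ge power_le_one)
    finally show "pmf \<mu> j * s\<^sup>2 \<le> gen_fun \<mu> (1 - s) - 1 + s"
      by (simp add: gen_fun_defect(1)[OF assms(1) s])
  qed
qed

text \<open>
  This is the source of the constant in the theorem. Write \<open>h\<^sub>i s = gen_fun \<mu>\<^sub>i (1 - s) - 1 + s\<close>, so
  that \<open>h\<^sub>1 s \<le> b s\<^sup>2\<close> and \<open>h\<^sub>2 s \<ge> a s\<^sup>2\<close>. In \<open>K s - h\<^sub>2 (K s) \<le> K (s - a K s\<^sup>2)\<close> the scaling by \<open>K\<close>
  enters the quadratic term twice, so \<open>K \<ge> b / a\<close> makes it dominate \<open>h\<^sub>1\<close>. In terms of the recursion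
  for hitting probabilities, \<open>K\<close> times a solution for \<open>\<mu>1\<close> is a supersolution for \<open>\<mu>2\<close>.
\<close>
lemma gen_fun_comparison:
  assumes "critical \<mu>1" "finite_second_moment \<mu>1" "critical \<mu>2" "nondegenerate \<mu>2"
  obtains K where "1 \<le> K"
    "\<And>s t. \<lbrakk>0 \<le> s; s \<le> 1; 0 \<le> t; t \<le> 1; t \<le> K * s\<rbrakk> \<Longrightarrow>
       1 - gen_fun \<mu>2 (1 - t) \<le> K * (1 - gen_fun \<mu>1 (1 - s))"
proof -
  obtain b where b: "0 < b" "\<And>s. 0 \<le> s \<Longrightarrow> s \<le> 1 \<Longrightarrow> gen_fun \<mu>1 (1 - s) - 1 + s \<le> b * s\<^sup>2"
    using gen_fun_defect_le[OF assms(1,2)] by blast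
  obtain a where a: "0 < a" "\<And>s. 0 \<le> s \<Longrightarrow> s \<le> 1 \<Longrightarrow> a * s\<^sup>2 \<le> gen_fun \<mu>2 (1 - s) - 1 + s"
    using gen_fun_defect_ge[OF assms(3,4)] by blast
  define K where "K = max 1 (b / a)"
  have K: "1 \<le> K" "b \<le> a * K"
    using a(1) by (auto simp: K_def max_def field_simps)
  show ?thesis
  proof
    show "1 \<le> K" by fact
    fix s t :: real assume st: "0 \<le> s" "s \<le> 1" "0 \<le> t" "t \<le> 1" "t \<le> K * s"
    \<comment> \<open>Lowering \<open>s\<close> to \<open>1 / K\<close> keeps \<open>K r\<close> in the domain \<open>[0, 1]\<close>, and loses nothing because \<open>t \<le> 1\<close>.\<close>
    define r where "r = min s (1 / K)"
    have r: "0 \<le> r" "r \<le> s" "r \<le> 1" "K * r \<le> 1" "t \<le> K * r" "0 \<le> K * r"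
      using st K by (auto simp: r_def min_def field_simps)
    have "1 - gen_fun \<mu>2 (1 - t) \<le> 1 - gen_fun \<mu>2 (1 - K * r)"
      using gen_fun_mono[of "1 - K * r" "1 - t" \<mu>2] r st by simp
    also have "\<dots> \<le> K * r - a * (K * r)\<^sup>2"
      using a(2)[of "K * r"] r by simp
    also have "\<dots> = K * (r - a * K * r\<^sup>2)"
      by (simp add: power2_eq_square algebra_simps)
    also have "\<dots> \<le> K * (r - b * r\<^sup>2)"
      using K by (intro mult_left_mono diff_left_mono mult_right_mono) auto
    also have "\<dots> \<le> K * (1 - gen_fun \<mu>1 (1 - r))"
      using b(2)[of r] r K by (intro mult_left_mono) auto
    also have "\<dots> \<le> K * (1 - gen_fun \<mu>1 (1 - s))"
      using gen_fun_mono[of "1 - s" "1 - r" \<mu>1] r st K by (intro mult_left_mono) auto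
    finally show "1 - gen_fun \<mu>2 (1 - t) \<le> K * (1 - gen_fun \<mu>1 (1 - s))" .
  qed
qed

section \<open>Duality of the walk and its reversal\<close>

lemma jump_mean_unit:
  assumes "\<And>x. 0 \<le> u x \<and> u x \<le> 1"
  shows "0 \<le> jump_mean \<theta> u x" "jump_mean \<theta> u x \<le> 1"
  unfolding jump_mean_def using assms by (intro expectation_pmf_unit; simp)+

lemma jump_mean_mono:
  assumes "\<And>x. 0 \<le> u x \<and> u x \<le> v x \<and> v x \<le> 1"
  shows "jump_mean \<theta> u x \<le> jump_mean \<theta> v x"
proof -
  have "0 \<le> u x \<and> u x \<le> 1" "0 \<le> v x \<and> v x \<le> 1" for x
    using assms[of x] by auto
  then show ?thesis
    unfolding jump_mean_def using assms by (intro integral_mono integrable_pmf_unit) auto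
qed

lemma ennreal_jump_mean:
  assumes "\<And>x. 0 \<le> u x \<and> u x \<le> 1"
  shows "ennreal (jump_mean \<theta> u x) = (\<integral>\<^sup>+z. ennreal (u (x + z)) \<partial>measure_pmf \<theta>)"
  unfolding jump_mean_def using assms
  by (intro nn_integral_eq_integral[symmetric] integrable_pmf_unit) auto

text \<open>
  The pairing takes values in the extended nonnegative reals, so that sums over the whole lattice
  can be exchanged before anything is known to be finite.
\<close>
definition pairing :: "('a \<Rightarrow> real) \<Rightarrow> ('a \<Rightarrow> real) \<Rightarrow> ennreal" where
  "pairing u v = (\<integral>\<^sup>+x. ennreal (u x * v x) \<partial>count_space UNIV)"

lemma pairing_mono:
  assumes "\<And>x. 0 \<le> u x" "\<And>x. 0 \<le> v x" "\<And>x. u x \<le> u' x" "\<And>x. v x \<le> v' x"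
  shows "pairing u v \<le> pairing u' v'"
  unfolding pairing_def using assms
  by (intro nn_integral_mono ennreal_leI mult_mono) (auto intro: order_trans)

lemma pairing_indicator:
  assumes "finite A" "\<And>x. 0 \<le> v x"
  shows "pairing (indicator A) v = ennreal (\<Sum>x\<in>A. v x)"
proof -
  have "pairing (indicator A) v = (\<Sum>x\<in>A. ennreal (indicator A x * v x))"
    unfolding pairing_def using assms(1) by (intro nn_integral_count_space') auto
  also have "\<dots> = (\<Sum>x\<in>A. ennreal (v x))" by simp
  also have "\<dots> = ennreal (\<Sum>x\<in>A. v x)" using assms(2) by (intro sum_ennreal)
  finally show ?thesis .
qed

text \<open>
  Translation invariance of counting measure: substitute \<open>x - z\<close> for \<open>x\<close> in the sum over \<open>x\<close>, for
  each jump \<open>z\<close>.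
\<close>
lemma pairing_jump_mean:
  fixes u v :: "'a::ab_group_add \<Rightarrow> real"
  assumes u: "\<And>x. 0 \<le> u x \<and> u x \<le> 1" and v: "\<And>x. 0 \<le> v x \<and> v x \<le> 1"
  shows "pairing (jump_mean \<theta> u) v = pairing u (jump_mean (map_pmf uminus \<theta>) v)"
proof -
  let ?c = "count_space (UNIV :: 'a set)"
  let ?f = "\<lambda>x z. ennreal (pmf \<theta> z) * (ennreal (u (x + z)) * ennreal (v x))"
  have "pairing (jump_mean \<theta> u) v = (\<integral>\<^sup>+x. (\<integral>\<^sup>+z. ?f x z \<partial>?c) \<partial>?c)"
    unfolding pairing_def
  proof (intro nn_integral_cong)
    fix x
    have "ennreal (jump_mean \<theta> u x * v x) = ennreal (jump_mean \<theta> u x) * ennreal (v x)"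
      using jump_mean_unit[OF u] v by (intro ennreal_mult) auto
    also have "\<dots> = (\<integral>\<^sup>+z. ennreal (u (x + z)) * ennreal (v x) \<partial>measure_pmf \<theta>)"
      unfolding ennreal_jump_mean[OF u] by (intro nn_integral_multc[symmetric]) auto
    finally show "ennreal (jump_mean \<theta> u x * v x) = (\<integral>\<^sup>+z. ?f x z \<partial>?c)"
      by (simp only: nn_integral_measure_pmf)
  qed
  also have "\<dots> = (\<integral>\<^sup>+z. (\<integral>\<^sup>+x. ?f x z \<partial>?c) \<partial>?c)"
    using nn_integral_fst_count_space[of "\<lambda>(x, z). ?f x z"]
      nn_integral_snd_count_space[of "\<lambda>(x, z). ?f x z"] by simp
  also have "\<dots> = (\<integral>\<^sup>+z. (\<integral>\<^sup>+x. ?f (x - z) z \<partial>?c) \<partial>?c)"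
  proof (rule nn_integral_cong)
    fix z :: 'a
    have "bij_betw (\<lambda>x. x - z) UNIV UNIV"
      by (rule bij_betwI[where g = "\<lambda>x. x + z"]) auto
    then show "(\<integral>\<^sup>+x. ?f x z \<partial>?c) = (\<integral>\<^sup>+x. ?f (x - z) z \<partial>?c)"
      by (rule nn_integral_bij_count_space[symmetric])
  qed
  also have "\<dots> = (\<integral>\<^sup>+x. (\<integral>\<^sup>+z. ?f (x - z) z \<partial>?c) \<partial>?c)"
    using nn_integral_fst_count_space[of "\<lambda>(x, z). ?f (x - z) z"]
      nn_integral_snd_count_space[of "\<lambda>(x, z). ?f (x - z) z"] by simp
  also have "\<dots> = pairing u (jump_mean (map_pmf uminus \<theta>) v)"
    unfolding pairing_def
  proof (intro nn_integral_cong)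
    fix x
    have "ennreal (u x * jump_mean (map_pmf uminus \<theta>) v x)
        = ennreal (u x) * ennreal (jump_mean (map_pmf uminus \<theta>) v x)"
      using jump_mean_unit[OF v] u by (intro ennreal_mult) auto
    also have "\<dots> = (\<integral>\<^sup>+z. ennreal (u x) * ennreal (v (x - z)) \<partial>measure_pmf \<theta>)"
      unfolding ennreal_jump_mean[OF v] by (subst nn_integral_cmult[symmetric]) auto
    also have "\<dots> = (\<integral>\<^sup>+z. ennreal (pmf \<theta> z) * (ennreal (u x) * ennreal (v (x - z))) \<partial>?c)"
      by (rule nn_integral_measure_pmf)
    finally show "(\<integral>\<^sup>+z. ?f (x - z) z \<partial>?c)
        = ennreal (u x * jump_mean (map_pmf uminus \<theta>) v x)" by simp
  qed
  finally show ?thesis .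
qed

section \<open>Recursions for hitting and escaping\<close>

text \<open>
  \<open>hit \<mu> \<theta> A n x\<close> is the probability that the snake from \<open>x\<close> on a \<open>\<mu>\<close>-Galton--Watson tree hits \<open>A\<close>
  in its first \<open>n\<close> generations: from a point outside \<open>A\<close>, it misses \<open>A\<close> exactly if the snakes
  grafted to the children of the root all do, and these are independent. \<open>bush_miss\<close> is the
  probability that a bush whose root is at \<open>x\<close> misses \<open>A\<close> up to generation \<open>l + 1\<close>, and \<open>spine_miss\<close>
  that this happens for each of the \<open>k\<close> bushes that the reversed walk from \<open>x\<close> meets at times
  \<open>1, ..., k\<close>. They are given by recursions here, and \<open>prob_branch_avoids\<close> and \<open>prob_spine_avoids\<close>
  identify the recursions with probabilities.
\<close>
primrec hit :: "nat pmf \<Rightarrow> 'a::ab_group_add pmf \<Rightarrow> 'a set \<Rightarrow> nat \<Rightarrow> 'a \<Rightarrow> real" where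
  "hit \<mu> \<theta> A 0 = indicator A"
| "hit \<mu> \<theta> A (Suc n) = (\<lambda>x. if x \<in> A then 1 else 1 - gen_fun \<mu> (1 - jump_mean \<theta> (hit \<mu> \<theta> A n) x))"

definition bush_miss :: "nat pmf \<Rightarrow> 'a::ab_group_add pmf \<Rightarrow> 'a set \<Rightarrow> nat \<Rightarrow> 'a \<Rightarrow> real" where
  "bush_miss \<mu> \<theta> A l x =
     (if x \<in> A then 0 else gen_fun (adjoint_pmf \<mu>) (1 - jump_mean \<theta> (hit \<mu> \<theta> A l) x))"

primrec spine_miss :: "nat pmf \<Rightarrow> 'a::ab_group_add pmf \<Rightarrow> 'a set \<Rightarrow> nat \<Rightarrow> nat \<Rightarrow> 'a \<Rightarrow> real" where
  "spine_miss \<mu> \<theta> A l 0 = (\<lambda>x. 1)"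
| "spine_miss \<mu> \<theta> A l (Suc k) =
     jump_mean (map_pmf uminus \<theta>) (\<lambda>y. bush_miss \<mu> \<theta> A l y * spine_miss \<mu> \<theta> A l k y)"

lemma unit_interval_mult:
  fixes a b :: real
  assumes "0 \<le> a \<and> a \<le> 1" "0 \<le> b \<and> b \<le> 1"
  shows "0 \<le> a * b \<and> a * b \<le> 1"
  using assms by (simp add: mult_le_one)

lemma hit_unit: "0 \<le> hit \<mu> \<theta> A n x \<and> hit \<mu> \<theta> A n x \<le> 1"
proof (induction n arbitrary: x)
  case (Suc n)
  then show ?case
    using gen_fun_unit[of "1 - jump_mean \<theta> (hit \<mu> \<theta> A n) x" \<mu>]
      jump_mean_unit[of "hit \<mu> \<theta> A n" \<theta> x] by simp
qed (simp add: indicator_def)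

lemma jump_mean_hit_unit:
  "0 \<le> jump_mean \<theta> (hit \<mu> \<theta>' A n) x" "jump_mean \<theta> (hit \<mu> \<theta>' A n) x \<le> 1"
  by (rule jump_mean_unit, rule hit_unit)+

lemma hit_mono_Suc: "hit \<mu> \<theta> A n x \<le> hit \<mu> \<theta> A (Suc n) x"
proof (induction n arbitrary: x)
  case 0
  show ?case using hit_unit[of \<mu> \<theta> A 1 x] by (auto simp: indicator_def)
next
  case (Suc n)
  have "jump_mean \<theta> (hit \<mu> \<theta> A n) x \<le> jump_mean \<theta> (hit \<mu> \<theta> A (Suc n)) x"
    using Suc hit_unit by (intro jump_mean_mono conjI) blast+
  then have "gen_fun \<mu> (1 - jump_mean \<theta> (hit \<mu> \<theta> A (Suc n)) x)
      \<le> gen_fun \<mu> (1 - jump_mean \<theta> (hit \<mu> \<theta> A n) x)"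
    using jump_mean_hit_unit by (intro gen_fun_mono) (auto simp del: hit.simps)
  then show ?case by simp
qed

lemma hit_mono: "m \<le> n \<Longrightarrow> hit \<mu> \<theta> A m x \<le> hit \<mu> \<theta> A n x"
  by (rule lift_Suc_mono_le[where f = "\<lambda>n. hit \<mu> \<theta> A n x"]) (rule hit_mono_Suc)

lemma bush_miss_unit: "0 \<le> bush_miss \<mu> \<theta> A l x \<and> bush_miss \<mu> \<theta> A l x \<le> 1"
  unfolding bush_miss_def by (simp add: gen_fun_unit jump_mean_hit_unit)

lemma bush_miss_antimono:
  assumes "l \<le> m" shows "bush_miss \<mu> \<theta> A m x \<le> bush_miss \<mu> \<theta> A l x"
proof -
  have "jump_mean \<theta> (hit \<mu> \<theta> A l) x \<le> jump_mean \<theta> (hit \<mu> \<theta> A m) x"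
    using assms by (intro jump_mean_mono) (auto simp: hit_unit hit_mono)
  then show ?thesis
    by (auto simp: bush_miss_def jump_mean_hit_unit intro!: gen_fun_mono)
qed

lemma spine_miss_unit: "0 \<le> spine_miss \<mu> \<theta> A l k x \<and> spine_miss \<mu> \<theta> A l k x \<le> 1"
proof (induction k arbitrary: x)
  case (Suc k)
  show ?case
    unfolding spine_miss.simps
    by (intro conjI jump_mean_unit unit_interval_mult bush_miss_unit Suc)
qed simp

lemma spine_miss_antimono_Suc: "spine_miss \<mu> \<theta> A l (Suc k) x \<le> spine_miss \<mu> \<theta> A l k x"
proof (induction k arbitrary: x)
  case 0
  show ?case using spine_miss_unit[of \<mu> \<theta> A l 1 x] by simp
next
  case (Suc k)
  have "bush_miss \<mu> \<theta> A l y * spine_miss \<mu> \<theta> A l (Suc k) y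
      \<le> bush_miss \<mu> \<theta> A l y * spine_miss \<mu> \<theta> A l k y" for y
    by (intro mult_left_mono Suc) (simp add: bush_miss_unit)
  then show ?case
    using unit_interval_mult[OF bush_miss_unit spine_miss_unit]
    by (subst (1 2) spine_miss.simps(2)) (intro jump_mean_mono conjI, blast+)
qed

lemma spine_miss_antimono: "j \<le> k \<Longrightarrow> spine_miss \<mu> \<theta> A l k x \<le> spine_miss \<mu> \<theta> A l j x"
  by (rule lift_Suc_antimono_le[where f = "\<lambda>k. spine_miss \<mu> \<theta> A l k x"])
    (rule spine_miss_antimono_Suc)

text \<open>
  The linear recursion: a snake hits \<open>A\<close> if it does so along a random walk that is killed, at each
  point, with the probability that an independent bush rooted there hits \<open>A\<close>. The walk is the path
  from the root to the first vertex, in depth-first order, that is mapped into \<open>A\<close>, and the bushes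
  are what the tree has to the left of this path.
\<close>
lemma hit_Suc_bush:
  assumes "critical \<mu>"
  shows "hit \<mu> \<theta> A (Suc n) x
    = indicator A x + bush_miss \<mu> \<theta> A n x * jump_mean \<theta> (hit \<mu> \<theta> A n) x"
  using gen_fun_adjoint[OF assms, of "1 - jump_mean \<theta> (hit \<mu> \<theta> A n) x"]
    jump_mean_hit_unit[of \<theta> \<mu> \<theta> A n x]
  by (auto simp: bush_miss_def)

section \<open>The capacity as a growth rate\<close>

text \<open>
  Pairing the linear recursion with \<open>v\<close> and moving the walk to the other side by duality produces
  one reversed step past a bush, which is the step that defines \<open>spine_miss\<close>.
\<close>
lemma pairing_hit_Suc:
  assumes "critical \<mu>" "finite A" and v: "\<And>x. 0 \<le> v x \<and> v x \<le> 1"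
  shows "pairing (hit \<mu> \<theta> A (Suc n)) v
    = ennreal (\<Sum>x\<in>A. v x)
      + pairing (hit \<mu> \<theta> A n) (jump_mean (map_pmf uminus \<theta>) (\<lambda>y. bush_miss \<mu> \<theta> A n y * v y))"
proof -
  have w: "0 \<le> bush_miss \<mu> \<theta> A n x * v x \<and> bush_miss \<mu> \<theta> A n x * v x \<le> 1" for x
    by (intro unit_interval_mult bush_miss_unit v)
  have "pairing (hit \<mu> \<theta> A (Suc n)) v = (\<integral>\<^sup>+x. ennreal (indicator A x * v x) +
      ennreal (jump_mean \<theta> (hit \<mu> \<theta> A n) x * (bush_miss \<mu> \<theta> A n x * v x)) \<partial>count_space UNIV)"
    unfolding pairing_def hit_Suc_bush[OF assms(1)]
  proof (intro nn_integral_cong)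
    fix x
    let ?h = "jump_mean \<theta> (hit \<mu> \<theta> A n) x" and ?b = "bush_miss \<mu> \<theta> A n x"
    have "0 \<le> ?h * (?b * v x)"
      using w[of x] by (intro mult_nonneg_nonneg[of ?h]) (simp_all add: jump_mean_hit_unit)
    moreover have "(indicator A x + ?b * ?h) * v x = indicator A x * v x + ?h * (?b * v x)"
      by (simp add: algebra_simps)
    ultimately show "ennreal ((indicator A x + ?b * ?h) * v x)
        = ennreal (indicator A x * v x) + ennreal (?h * (?b * v x))"
      by (simp add: ennreal_plus v)
  qed
  also have "\<dots> = pairing (indicator A) v
      + pairing (jump_mean \<theta> (hit \<mu> \<theta> A n)) (\<lambda>y. bush_miss \<mu> \<theta> A n y * v y)"
    unfolding pairing_def by (intro nn_integral_add) auto
  finally show ?thesis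
    using v assms(2) by (simp add: pairing_jump_mean[OF hit_unit w] pairing_indicator)
qed

text \<open>
  Unrolling \<open>pairing_hit_Suc\<close> down to generation \<open>0\<close> gives one sum over \<open>A\<close> per generation. The
  bushes that kill are truncated at various levels up to \<open>n \<le> l\<close>, and they miss \<open>A\<close> more easily than
  those truncated at \<open>l\<close>. In \<open>pairing_hit_le\<close> the unrolling stops at generation \<open>l\<close>, so that all
  levels involved are at least \<open>l\<close> and the comparison goes the other way.
\<close>
lemma pairing_hit_ge:
  assumes "critical \<mu>" "finite A" "n \<le> l"
  shows "ennreal (\<Sum>i\<le>n. \<Sum>x\<in>A. spine_miss \<mu> \<theta> A l (j + i) x)
    \<le> pairing (hit \<mu> \<theta> A n) (spine_miss \<mu> \<theta> A l j)"
  using assms(3)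
proof (induction n arbitrary: j)
  case 0
  then show ?case using spine_miss_unit[of \<mu> \<theta> A l] assms(2) by (simp add: pairing_indicator)
next
  case (Suc n)
  let ?S = "\<lambda>k. \<Sum>x\<in>A. spine_miss \<mu> \<theta> A l k x"
  have nn: "0 \<le> ?S k" for k
    by (intro sum_nonneg) (simp add: spine_miss_unit)
  have "ennreal (\<Sum>i\<le>Suc n. ?S (j + i)) = ennreal (?S j) + ennreal (\<Sum>i\<le>n. ?S (Suc j + i))"
    using nn by (subst sum.atMost_Suc_shift) (simp add: ennreal_plus sum_nonneg del: spine_miss.simps)
  also have "\<dots> \<le> ennreal (?S j) + pairing (hit \<mu> \<theta> A n) (spine_miss \<mu> \<theta> A l (Suc j))"
    using Suc by (intro add_left_mono Suc.IH) simp
  also have "\<dots> \<le> ennreal (?S j) + pairing (hit \<mu> \<theta> A n)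
      (jump_mean (map_pmf uminus \<theta>) (\<lambda>y. bush_miss \<mu> \<theta> A n y * spine_miss \<mu> \<theta> A l j y))"
  proof (intro add_left_mono pairing_mono)
    fix x
    show "spine_miss \<mu> \<theta> A l (Suc j) x
      \<le> jump_mean (map_pmf uminus \<theta>) (\<lambda>y. bush_miss \<mu> \<theta> A n y * spine_miss \<mu> \<theta> A l j y) x"
      using Suc.prems by (simp, intro jump_mean_mono conjI mult_right_mono bush_miss_antimono)
        (auto simp: bush_miss_unit spine_miss_unit mult_le_one)
    show "0 \<le> spine_miss \<mu> \<theta> A l (Suc j) x" using spine_miss_unit by blast
  qed (auto simp: hit_unit)
  also have "\<dots> = pairing (hit \<mu> \<theta> A (Suc n)) (spine_miss \<mu> \<theta> A l j)"
    by (rule pairing_hit_Suc[OF assms(1,2) spine_miss_unit, symmetric])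
  finally show ?case .
qed

lemma pairing_hit_le:
  assumes "critical \<mu>" "finite A"
  shows "pairing (hit \<mu> \<theta> A (l + n)) (spine_miss \<mu> \<theta> A l j)
    \<le> ennreal (\<Sum>i<n. \<Sum>x\<in>A. spine_miss \<mu> \<theta> A l (j + i) x)
      + pairing (hit \<mu> \<theta> A l) (spine_miss \<mu> \<theta> A l (j + n))"
proof (induction n arbitrary: j)
  case (Suc n)
  let ?S = "\<lambda>k. \<Sum>x\<in>A. spine_miss \<mu> \<theta> A l k x"
  have nn: "0 \<le> ?S k" for k
    by (intro sum_nonneg) (simp add: spine_miss_unit)
  have "pairing (hit \<mu> \<theta> A (l + Suc n)) (spine_miss \<mu> \<theta> A l j)
    = ennreal (?S j) + pairing (hit \<mu> \<theta> A (l + n))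
      (jump_mean (map_pmf uminus \<theta>) (\<lambda>y. bush_miss \<mu> \<theta> A (l + n) y * spine_miss \<mu> \<theta> A l j y))"
    unfolding add_Suc_right by (rule pairing_hit_Suc[OF assms spine_miss_unit])
  also have "\<dots> \<le> ennreal (?S j) + pairing (hit \<mu> \<theta> A (l + n)) (spine_miss \<mu> \<theta> A l (Suc j))"
  proof (intro add_left_mono pairing_mono)
    fix x
    show "jump_mean (map_pmf uminus \<theta>) (\<lambda>y. bush_miss \<mu> \<theta> A (l + n) y * spine_miss \<mu> \<theta> A l j y) x
      \<le> spine_miss \<mu> \<theta> A l (Suc j) x"
      by (simp, intro jump_mean_mono conjI mult_right_mono bush_miss_antimono)
        (auto simp: bush_miss_unit spine_miss_unit mult_le_one)
    show "0 \<le> jump_mean (map_pmf uminus \<theta>) (\<lambda>y. bush_miss \<mu> \<theta> A (l + n) y * spine_miss \<mu> \<theta> A l j y) x"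
      by (intro jump_mean_unit unit_interval_mult bush_miss_unit spine_miss_unit)
  qed (auto simp: hit_unit)
  also have "\<dots> \<le> ennreal (?S j) + (ennreal (\<Sum>i<n. ?S (Suc j + i))
      + pairing (hit \<mu> \<theta> A l) (spine_miss \<mu> \<theta> A l (Suc j + n)))"
    by (intro add_left_mono Suc.IH)
  also have "\<dots> = ennreal (\<Sum>i<Suc n. ?S (j + i))
      + pairing (hit \<mu> \<theta> A l) (spine_miss \<mu> \<theta> A l (j + Suc n))"
    using nn by (subst sum.lessThan_Suc_shift)
      (simp add: ennreal_plus sum_nonneg add.assoc del: spine_miss.simps)
  finally show ?case .
qed simp

text \<open>
  The sum of the truncated hitting probabilities over all starting points grows linearly in the
  number of generations, with the capacity as slope: \<open>hit_mass_ge\<close> and \<open>hit_mass_le\<close> bound the slope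
  from below and above.
\<close>
definition hit_mass :: "nat pmf \<Rightarrow> 'a::ab_group_add pmf \<Rightarrow> 'a set \<Rightarrow> nat \<Rightarrow> ennreal" where
  "hit_mass \<mu> \<theta> A n = pairing (hit \<mu> \<theta> A n) (\<lambda>_. 1)"

lemma sum_spine_miss_le_card: "finite A \<Longrightarrow> (\<Sum>x\<in>A. spine_miss \<mu> \<theta> A l k x) \<le> card A"
  using sum_mono[of A "spine_miss \<mu> \<theta> A l k" "\<lambda>_. 1"] by (simp add: spine_miss_unit)

lemma hit_mass_ge:
  assumes "critical \<mu>" "finite A" "\<And>l k x. x \<in> A \<Longrightarrow> e x \<le> spine_miss \<mu> \<theta> A l k x"
  shows "ennreal (real (Suc n) * (\<Sum>x\<in>A. e x)) \<le> hit_mass \<mu> \<theta> A n"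
proof -
  have "real (Suc n) * (\<Sum>x\<in>A. e x) = (\<Sum>i\<le>n. \<Sum>x\<in>A. e x)" by simp
  also have "\<dots> \<le> (\<Sum>i\<le>n. \<Sum>x\<in>A. spine_miss \<mu> \<theta> A n (0 + i) x)"
    by (intro sum_mono assms(3))
  finally have "ennreal (real (Suc n) * (\<Sum>x\<in>A. e x))
      \<le> ennreal (\<Sum>i\<le>n. \<Sum>x\<in>A. spine_miss \<mu> \<theta> A n (0 + i) x)"
    by (rule ennreal_leI)
  also have "\<dots> \<le> hit_mass \<mu> \<theta> A n"
    using pairing_hit_ge[OF assms(1,2) order_refl, of \<theta> n 0] by (simp add: hit_mass_def)
  finally show ?thesis .
qed

text \<open>
  By monotonicity in \<open>k\<close>, all terms \<open>spine_miss \<mu> \<theta> A l k\<close> with \<open>k \<ge> l\<close> are at most the one for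
  \<open>k = l\<close>; the generations up to \<open>l\<close> and the terms with \<open>k < l\<close> contribute amounts that do not grow
  with \<open>n\<close>.
\<close>
lemma hit_mass_le:
  assumes "critical \<mu>" "finite A"
  shows "hit_mass \<mu> \<theta> A (l + n)
    \<le> ennreal (real (2 * l + 1) * card A + real n * (\<Sum>x\<in>A. spine_miss \<mu> \<theta> A l l x))"
proof -
  let ?S = "\<lambda>l k. \<Sum>x\<in>A. spine_miss \<mu> \<theta> A l k x"
  have nn: "0 \<le> ?S l k" for l k
    by (intro sum_nonneg) (simp add: spine_miss_unit)
  have "hit_mass \<mu> \<theta> A l \<le> ennreal ((\<Sum>i<l. ?S 0 i) + ?S 0 l)"
    using pairing_hit_le[OF assms, of \<theta> 0 l 0] nn assms(2) spine_miss_unit[of \<mu> \<theta> A 0 l]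
    by (simp add: hit_mass_def pairing_indicator sum_nonneg)
  also have "\<dots> \<le> ennreal (real (l + 1) * card A)"
    using sum_mono[of "{..<l}" "\<lambda>i. ?S 0 i" "\<lambda>_. real (card A)"]
      sum_spine_miss_le_card[OF assms(2), of \<mu> \<theta> 0]
    by (intro ennreal_leI) (simp add: algebra_simps add_mono)
  finally have 1: "hit_mass \<mu> \<theta> A l \<le> ennreal (real (l + 1) * card A)" .
  have "(\<Sum>i<n. ?S l i) \<le> (\<Sum>i<n. (if i < l then real (card A) else 0) + ?S l l)"
  proof (intro sum_mono)
    fix i
    show "?S l i \<le> (if i < l then real (card A) else 0) + ?S l l"
      using sum_spine_miss_le_card[OF assms(2), of \<mu> \<theta> l i] nn[of l l]
      by (auto intro!: sum_mono spine_miss_antimono add_increasing2)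
  qed
  also have "\<dots> = (\<Sum>i\<in>{..<n} \<inter> {..<l}. real (card A)) + real n * ?S l l"
    by (simp add: sum.distrib sum.If_cases lessThan_def)
  also have "\<dots> \<le> real l * card A + real n * ?S l l"
    using card_mono[of "{..<l}" "{..<n} \<inter> {..<l}"] by (simp add: mult_right_mono)
  finally have 2: "(\<Sum>i<n. ?S l i) \<le> real l * card A + real n * ?S l l" .
  have "hit_mass \<mu> \<theta> A (l + n) \<le> ennreal (\<Sum>i<n. ?S l i)
      + pairing (hit \<mu> \<theta> A l) (spine_miss \<mu> \<theta> A l n)"
    using pairing_hit_le[OF assms, of \<theta> l n 0] by (simp add: hit_mass_def)
  also have "\<dots> \<le> ennreal (real l * card A + real n * ?S l l) + hit_mass \<mu> \<theta> A l"
    unfolding hit_mass_def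
    by (intro add_mono ennreal_leI 2 pairing_mono) (auto simp: hit_unit spine_miss_unit)
  also have "\<dots> \<le> ennreal (real l * card A + real n * ?S l l) + ennreal (real (l + 1) * card A)"
    by (intro add_left_mono 1)
  also have "\<dots> = ennreal (real (2 * l + 1) * card A + real n * ?S l l)"
    using nn[of l l] by (subst ennreal_plus[symmetric]) (auto simp: algebra_simps)
  finally show ?thesis .
qed

section \<open>Comparison of two offspring distributions\<close>

text \<open>
  The comparison principle, in the form of an induction over generations. The constant is the same
  for all \<open>\<theta>\<close> and \<open>A\<close> because it enters only through the offspring distributions.
\<close>
lemma hit_comparison:
  assumes K: "1 \<le> K"
    "\<And>s t. \<lbrakk>0 \<le> s; s \<le> 1; 0 \<le> t; t \<le> 1; t \<le> K * s\<rbrakk> \<Longrightarrow>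
       1 - gen_fun \<mu>2 (1 - t) \<le> K * (1 - gen_fun \<mu>1 (1 - s))"
  shows "hit \<mu>2 \<theta> A n x \<le> K * hit \<mu>1 \<theta> A n x"
proof (induction n arbitrary: x)
  case 0
  show ?case using K(1) by (simp add: indicator_def)
next
  case (Suc n)
  let ?s = "jump_mean \<theta> (hit \<mu>1 \<theta> A n) x" and ?t = "jump_mean \<theta> (hit \<mu>2 \<theta> A n) x"
  have "?t \<le> measure_pmf.expectation \<theta> (\<lambda>z. K * hit \<mu>1 \<theta> A n (x + z))"
    unfolding jump_mean_def
    by (intro integral_mono Suc integrable_mult_right integrable_pmf_unit) (auto simp: hit_unit)
  then have "?t \<le> K * ?s" by (simp add: jump_mean_def)
  then have "1 - gen_fun \<mu>2 (1 - ?t) \<le> K * (1 - gen_fun \<mu>1 (1 - ?s))"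
    by (intro K(2) jump_mean_unit hit_unit)
  then show ?case using K(1) by simp
qed

text \<open>
  Comparing the slopes: by \<open>hit_mass_ge\<close> and \<open>hit_mass_le\<close>, the two sides of the pointwise
  comparison, summed over the lattice, grow at least like \<open>n\<close> times the sum of \<open>e2\<close> and at most like
  \<open>K\<close> times \<open>n\<close> times a sum that is close to that of \<open>e1\<close>. Letting \<open>n\<close> tend to infinity with \<open>l\<close>
  fixed, and then \<open>l\<close>, gives the result.
\<close>
lemma escape_sum_comparison:
  assumes K: "1 \<le> K"
    "\<And>s t. \<lbrakk>0 \<le> s; s \<le> 1; 0 \<le> t; t \<le> 1; t \<le> K * s\<rbrakk> \<Longrightarrow>
       1 - gen_fun \<mu>2 (1 - t) \<le> K * (1 - gen_fun \<mu>1 (1 - s))"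
    and crit: "critical \<mu>1" "critical \<mu>2" and A: "finite A"
    and e1: "\<And>x. x \<in> A \<Longrightarrow> (\<lambda>n. spine_miss \<mu>1 \<theta> A n n x) \<longlonglongrightarrow> e1 x"
    and e2: "\<And>l k x. x \<in> A \<Longrightarrow> e2 x \<le> spine_miss \<mu>2 \<theta> A l k x"
  shows "(\<Sum>x\<in>A. e2 x) \<le> K * (\<Sum>x\<in>A. e1 x)"
proof (rule LIMSEQ_le_const)
  let ?S = "\<lambda>l. \<Sum>x\<in>A. spine_miss \<mu>1 \<theta> A l l x"
  show "(\<lambda>l. K * ?S l) \<longlonglongrightarrow> K * (\<Sum>x\<in>A. e1 x)"
    by (intro tendsto_mult_left tendsto_sum e1)
  have mass: "hit_mass \<mu>2 \<theta> A n \<le> ennreal K * hit_mass \<mu>1 \<theta> A n" for n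
  proof -
    have "hit_mass \<mu>2 \<theta> A n \<le> (\<integral>\<^sup>+x. ennreal K * ennreal (hit \<mu>1 \<theta> A n x * 1) \<partial>count_space UNIV)"
      unfolding hit_mass_def pairing_def using K(1) hit_comparison[OF K, of \<theta> A n]
      by (intro nn_integral_mono) (simp add: ennreal_mult[symmetric] hit_unit ennreal_leI)
    also have "\<dots> = ennreal K * hit_mass \<mu>1 \<theta> A n"
      unfolding hit_mass_def pairing_def by (rule nn_integral_cmult) simp
    finally show ?thesis .
  qed
  show "\<exists>N. \<forall>l\<ge>N. (\<Sum>x\<in>A. e2 x) \<le> K * ?S l"
  proof (intro exI allI impI)
    fix l
    have Snn: "0 \<le> ?S l" by (intro sum_nonneg) (simp add: spine_miss_unit)
    define b where "b = K * (real (2 * l + 1) * card A)"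
    have "real n * ((\<Sum>x\<in>A. e2 x) - K * ?S l) \<le> b + \<bar>real (Suc l) * (\<Sum>x\<in>A. e2 x)\<bar>" for n
    proof -
      have "ennreal (real (Suc (l + n)) * (\<Sum>x\<in>A. e2 x)) \<le> hit_mass \<mu>2 \<theta> A (l + n)"
        by (rule hit_mass_ge[OF crit(2) A e2])
      also have "\<dots> \<le> ennreal K * hit_mass \<mu>1 \<theta> A (l + n)" by (rule mass)
      also have "\<dots> \<le> ennreal K * ennreal (real (2 * l + 1) * card A + real n * ?S l)"
        by (intro mult_left_mono hit_mass_le crit A) auto
      also have "\<dots> = ennreal (K * (real (2 * l + 1) * card A + real n * ?S l))"
        using K(1) Snn by (intro ennreal_mult[symmetric]) auto
      finally have "real (Suc (l + n)) * (\<Sum>x\<in>A. e2 x) \<le> K * (real (2 * l + 1) * card A + real n * ?S l)"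
        using K(1) Snn by (subst (asm) ennreal_le_iff) auto
      then show ?thesis by (simp add: b_def algebra_simps)
    qed
    then have "\<not> 0 < (\<Sum>x\<in>A. e2 x) - K * ?S l"
      using reals_Archimedean3 by (metis not_le)
    then show "(\<Sum>x\<in>A. e2 x) \<le> K * ?S l" by simp
  qed
qed

section \<open>Independence in the reversed snake\<close>

text \<open>
  Edge variables are indexed by the endpoint farther from the root, so offspring and jump laws both
  change exactly at the spine vertices, which are the pairs \<open>(n, [])\<close>.
\<close>
definition offspring_law :: "nat pmf \<Rightarrow> vertex \<Rightarrow> nat pmf" where
  "offspring_law \<mu> v = (if snd v = [] then adjoint_pmf \<mu> else \<mu>)"

definition jump_law :: "(int ^ 'd::finite) pmf \<Rightarrow> vertex \<Rightarrow> (int ^ 'd) pmf" where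
  "jump_law \<theta> v = (if snd v = [] then map_pmf uminus \<theta> else \<theta>)"

lemma infinite_GW_altdef: "infinite_GW \<mu> = PiM UNIV (\<lambda>v. measure_pmf (offspring_law \<mu> v))"
  by (simp add: infinite_GW_def offspring_law_def case_prod_unfold)

lemma edge_variables_altdef: "edge_variables \<theta> = PiM UNIV (\<lambda>v. measure_pmf (jump_law \<theta> v))"
  by (simp add: edge_variables_def jump_law_def case_prod_unfold)

lemma prob_space_reversed_snake: "prob_space (reversed_snake \<mu> \<theta>)"
  unfolding reversed_snake_def infinite_GW_altdef edge_variables_altdef
  by (intro prob_space_pair prob_space_PiM) (simp_all add: measure_pmf.prob_space_axioms)

lemma space_reversed_snake [simp]: "space (reversed_snake \<mu> \<theta>) = UNIV"
  by (simp add: reversed_snake_def infinite_GW_altdef edge_variables_altdef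
      space_pair_measure space_PiM)

definition cylinder :: "vertex set \<Rightarrow> (vertex \<Rightarrow> nat set) \<Rightarrow> (vertex \<Rightarrow> 'b set) \<Rightarrow>
    ((vertex \<Rightarrow> nat) \<times> (vertex \<Rightarrow> 'b)) set" where
  "cylinder J B D = {N. \<forall>v\<in>J. N v \<in> B v} \<times> {X. \<forall>v\<in>J. X v \<in> D v}"

lemma
  assumes "finite J"
  shows cylinder_sets: "cylinder J B D \<in> sets (reversed_snake \<mu> \<theta>)"
    and measure_cylinder: "measure (reversed_snake \<mu> \<theta>) (cylinder J B D)
      = (\<Prod>v\<in>J. measure_pmf.prob (offspring_law \<mu> v) (B v) * measure_pmf.prob (jump_law \<theta> v) (D v))"
proof -
  let ?M1 = "\<lambda>v. measure_pmf (offspring_law \<mu> v)" and ?M2 = "\<lambda>v. measure_pmf (jump_law \<theta> v)"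
  interpret P1: product_prob_space ?M1 UNIV
    by unfold_locales
  interpret P2: product_prob_space ?M2 UNIV
    by unfold_locales
  interpret S: prob_space "reversed_snake \<mu> \<theta>"
    by (rule prob_space_reversed_snake)
  let ?S1 = "{N. \<forall>v\<in>J. N v \<in> B v}" and ?S2 = "{X. \<forall>v\<in>J. X v \<in> D v}"
  have S1: "?S1 \<in> sets (PiM UNIV ?M1)"
  proof -
    have "?S1 = prod_emb UNIV ?M1 J (Pi\<^sub>E J B)"
      by (auto simp: prod_emb_def space_PiM Pi_iff)
    then show ?thesis using assms by (simp add: sets_PiM_I)
  qed
  have S2: "?S2 \<in> sets (PiM UNIV ?M2)"
  proof -
    have "?S2 = prod_emb UNIV ?M2 J (Pi\<^sub>E J D)"
      by (auto simp: prod_emb_def space_PiM Pi_iff)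
    then show ?thesis using assms by (simp add: sets_PiM_I)
  qed
  show "cylinder J B D \<in> sets (reversed_snake \<mu> \<theta>)"
    using S1 S2 by (simp add: cylinder_def reversed_snake_def infinite_GW_altdef edge_variables_altdef)
  have e1: "emeasure (PiM UNIV ?M1) ?S1 = (\<Prod>v\<in>J. emeasure (?M1 v) (B v))"
    using P1.emeasure_PiM_Collect[of J B] assms by (simp add: space_PiM)
  have e2: "emeasure (PiM UNIV ?M2) ?S2 = (\<Prod>v\<in>J. emeasure (?M2 v) (D v))"
    using P2.emeasure_PiM_Collect[of J D] assms by (simp add: space_PiM)
  have "emeasure (reversed_snake \<mu> \<theta>) (cylinder J B D)
      = emeasure (PiM UNIV ?M1) ?S1 * emeasure (PiM UNIV ?M2) ?S2"
    unfolding cylinder_def reversed_snake_def infinite_GW_altdef edge_variables_altdef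
    by (rule P2.P.emeasure_pair_measure_Times[OF S1 S2])
  also have "\<dots> = ennreal (\<Prod>v\<in>J. measure (?M1 v) (B v) * measure (?M2 v) (D v))"
    unfolding e1 e2 prod.distrib[symmetric]
    by (subst prod_ennreal[symmetric])
      (auto simp: measure_pmf.emeasure_eq_measure ennreal_mult)
  finally show "measure (reversed_snake \<mu> \<theta>) (cylinder J B D)
      = (\<Prod>v\<in>J. measure (?M1 v) (B v) * measure (?M2 v) (D v))"
    by (simp add: S.emeasure_eq_measure prod_nonneg)
qed

text \<open>
  Rectangles, rather than all events that depend on one vertex, because they are stable under
  intersection and have product probabilities. The events determined by a set \<open>V\<close> of vertices are
  the \<open>\<sigma>\<close>-algebra that they generate; it does not depend on the measure.
\<close>
definition vertex_events :: "vertex \<Rightarrow> ((vertex \<Rightarrow> nat) \<times> (vertex \<Rightarrow> 'b)) set set" where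
  "vertex_events v = {cylinder {v} B D | B D. True}"

definition region_events :: "vertex set \<Rightarrow> ((vertex \<Rightarrow> nat) \<times> (vertex \<Rightarrow> 'b)) set set" where
  "region_events V = sigma_sets UNIV (\<Union>v\<in>V. vertex_events v)"

lemma Int_stable_vertex_events: "Int_stable (vertex_events v)"
proof (rule Int_stableI)
  fix E F :: "((vertex \<Rightarrow> nat) \<times> (vertex \<Rightarrow> 'b)) set"
  assume "E \<in> vertex_events v" "F \<in> vertex_events v"
  then obtain B D B' D' where "E = cylinder {v} B D" "F = cylinder {v} B' D'"
    by (auto simp: vertex_events_def)
  then have "E \<inter> F = cylinder {v} (\<lambda>w. B w \<inter> B' w) (\<lambda>w. D w \<inter> D' w)"
    by (auto simp: cylinder_def)
  then show "E \<inter> F \<in> vertex_events v"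
    by (auto simp: vertex_events_def)
qed

lemma indep_vertex_events: "prob_space.indep_sets (reversed_snake \<mu> \<theta>) vertex_events UNIV"
proof -
  interpret prob_space "reversed_snake \<mu> \<theta>" by (rule prob_space_reversed_snake)
  show ?thesis
  proof (rule indep_setsI)
    fix v
    show "vertex_events v \<subseteq> events"
      by (auto simp: vertex_events_def cylinder_sets)
  next
    fix J :: "vertex set" and E :: "vertex \<Rightarrow> ((vertex \<Rightarrow> nat) \<times> (vertex \<Rightarrow> int ^ 'a)) set"
    assume J: "finite J" and "\<forall>v\<in>J. E v \<in> vertex_events v"
    then have "\<forall>v\<in>J. \<exists>b d. E v = cylinder {v} (\<lambda>_. b) (\<lambda>_. d)"
      unfolding vertex_events_def cylinder_def by fastforce
    then obtain B D where E: "\<And>v. v \<in> J \<Longrightarrow> E v = cylinder {v} (\<lambda>_. B v) (\<lambda>_. D v)"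
      by metis
    then have "(\<Inter>v\<in>J. E v) = cylinder J B D"
      by (auto simp: cylinder_def)
    then show "prob (\<Inter>v\<in>J. E v) = (\<Prod>v\<in>J. prob (E v))"
      by (simp add: measure_cylinder J E)
  qed
qed

lemma sigma_algebra_region_events: "sigma_algebra UNIV (region_events V)"
  unfolding region_events_def by (rule sigma_algebra_sigma_sets) simp

lemma region_events_mono: "V \<subseteq> W \<Longrightarrow> region_events V \<subseteq> region_events W"
  unfolding region_events_def by (intro sigma_sets_mono') auto

lemma region_events_sets: "B \<in> region_events V \<Longrightarrow> B \<in> sets (reversed_snake \<mu> \<theta>)"
proof -
  have "sigma_sets (space (reversed_snake \<mu> \<theta>)) (\<Union>v\<in>V. vertex_events v) \<subseteq> sets (reversed_snake \<mu> \<theta>)"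
    by (rule sets.sigma_sets_subset) (auto simp: vertex_events_def cylinder_sets)
  then show "B \<in> region_events V \<Longrightarrow> B \<in> sets (reversed_snake \<mu> \<theta>)"
    by (auto simp: region_events_def)
qed

lemma region_events_All_less:
  fixes j :: nat
  assumes "\<And>i. {\<omega>. P i \<omega>} \<in> region_events V"
  shows "{\<omega>. \<forall>i<j. P i \<omega>} \<in> region_events V"
proof -
  interpret sigma_algebra UNIV "region_events V" by (rule sigma_algebra_region_events)
  show ?thesis
    using assms by (induction j) (simp_all add: All_less_Suc Collect_conj_eq Int)
qed

lemma region_events_const: "{\<omega>. P} \<in> region_events V"
proof -
  interpret sigma_algebra UNIV "region_events V" by (rule sigma_algebra_region_events)
  show ?thesis by (cases P) simp_all
qed

lemma region_events_conj:
  assumes "{\<omega>. P \<omega>} \<in> region_events V" "{\<omega>. Q \<omega>} \<in> region_events V"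
  shows "{\<omega>. P \<omega> \<and> Q \<omega>} \<in> region_events V"
proof -
  interpret sigma_algebra UNIV "region_events V" by (rule sigma_algebra_region_events)
  show ?thesis using Int[OF assms] by (simp add: Collect_conj_eq)
qed

lemma resampling_decomposition:
  fixes B :: "nat \<Rightarrow> 'b \<Rightarrow> ((vertex \<Rightarrow> nat) \<times> (vertex \<Rightarrow> 'b)) set"
  shows "{\<omega>. \<omega> \<in> B (fst \<omega> v) (snd \<omega> v)}
    = (\<Union>(j, z)\<in>UNIV. cylinder {v} (\<lambda>_. {j}) (\<lambda>_. {z}) \<inter> B j z)"
  by (auto simp: cylinder_def)

text \<open>
  Events whose form depends on the values at \<open>v\<close> occur at every branching: the number of children
  and the position of \<open>v\<close> say which subtrees have to be controlled and where these start. Only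
  countably many values are possible, so such an event is a countable union.
\<close>
lemma region_events_resample:
  fixes B :: "nat \<Rightarrow> 'b::countable \<Rightarrow> ((vertex \<Rightarrow> nat) \<times> (vertex \<Rightarrow> 'b)) set"
  assumes "v \<in> V" "\<And>j z. B j z \<in> region_events V"
  shows "{\<omega>. \<omega> \<in> B (fst \<omega> v) (snd \<omega> v)} \<in> region_events V"
proof -
  interpret sigma_algebra UNIV "region_events V" by (rule sigma_algebra_region_events)
  have "cylinder {v} C D \<in> region_events V" for C D
    using assms(1) unfolding region_events_def vertex_events_def by (intro sigma_sets.Basic) auto
  then show ?thesis
    unfolding resampling_decomposition using assms(2)
    by (intro countable_UN'') (auto intro!: Int)
qed

lemma prob_disjoint_regions:
  fixes B :: "'i \<Rightarrow> ((vertex \<Rightarrow> nat) \<times> (vertex \<Rightarrow> int ^ 'd::finite)) set"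
  assumes "finite I" "disjoint_family_on V I" "\<And>i. i \<in> I \<Longrightarrow> B i \<in> region_events (V i)"
  shows "measure (reversed_snake \<mu> \<theta>) {\<omega>. \<forall>i\<in>I. \<omega> \<in> B i}
    = (\<Prod>i\<in>I. measure (reversed_snake \<mu> \<theta>) (B i))"
proof -
  interpret prob_space "reversed_snake \<mu> \<theta>" by (rule prob_space_reversed_snake)
  have "indep_sets (\<lambda>i. sigma_sets (space (reversed_snake \<mu> \<theta>)) (\<Union>v\<in>V i. vertex_events v)) I"
    using indep_vertex_events[of \<mu> \<theta>] assms(2)
    by (intro indep_sets_collect_sigma Int_stable_vertex_events)
      (auto intro: indep_sets_mono_index[rotated])
  then have indep: "indep_sets (\<lambda>i. region_events (V i)) I"
    by (simp add: region_events_def)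
  show ?thesis
  proof (cases "I = {}")
    case True
    then show ?thesis using prob_space by simp
  next
    case False
    have "{\<omega>. \<forall>i\<in>I. \<omega> \<in> B i} = (\<Inter>i\<in>I. B i)" by auto
    then show ?thesis
      using indep_setsD[OF indep order_refl False assms(1), of B] assms(3) by simp
  qed
qed

text \<open>
  The Markov property at a vertex: given the values at \<open>v\<close>, what happens in a region without \<open>v\<close>
  keeps its law.
\<close>
lemma emeasure_resample:
  fixes B :: "nat \<Rightarrow> int ^ 'd::finite \<Rightarrow> ((vertex \<Rightarrow> nat) \<times> (vertex \<Rightarrow> int ^ 'd)) set"
  assumes "v \<notin> V" "\<And>j z. B j z \<in> region_events V"
  shows "emeasure (reversed_snake \<mu> \<theta>) {\<omega>. \<omega> \<in> B (fst \<omega> v) (snd \<omega> v)}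
    = (\<integral>\<^sup>+z. (\<integral>\<^sup>+j. emeasure (reversed_snake \<mu> \<theta>) (B j z)
        \<partial>measure_pmf (offspring_law \<mu> v)) \<partial>measure_pmf (jump_law \<theta> v))"
proof -
  let ?M = "reversed_snake \<mu> \<theta>" and ?p = "offspring_law \<mu> v" and ?q = "jump_law \<theta> v"
  interpret prob_space ?M by (rule prob_space_reversed_snake)
  let ?C = "\<lambda>j z. cylinder {v} (\<lambda>_. {j}) (\<lambda>_. {z})"
  have sets: "?C j z \<inter> B j z \<in> sets ?M" for j z
    by (intro sets.Int cylinder_sets region_events_sets[OF assms(2)]) simp
  have prob: "emeasure ?M (?C j z \<inter> B j z)
      = ennreal (pmf (pair_pmf ?p ?q) (j, z)) * emeasure ?M (B j z)" for j z
  proof -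
    have "{\<omega>. \<forall>b\<in>UNIV. \<omega> \<in> (if b then ?C j z else B j z)} = ?C j z \<inter> B j z"
      by (auto simp: UNIV_bool)
    moreover have "measure ?M {\<omega>. \<forall>b\<in>UNIV. \<omega> \<in> (if b then ?C j z else B j z)}
        = (\<Prod>b\<in>UNIV. measure ?M (if b then ?C j z else B j z))"
    proof (rule prob_disjoint_regions[where V = "\<lambda>b. if b then {v} else V"])
      show "disjoint_family_on (\<lambda>b. if b then {v} else V) UNIV"
        using assms(1) by (auto simp: disjoint_family_on_def)
      show "(if b then ?C j z else B j z) \<in> region_events (if b then {v} else V)" for b
        using assms(2) by (auto simp: region_events_def vertex_events_def intro!: sigma_sets.Basic)
    qed simp
    ultimately have "measure ?M (?C j z \<inter> B j z) = measure ?M (?C j z) * measure ?M (B j z)"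
      by (simp add: UNIV_bool mult.commute)
    then show ?thesis
      by (simp add: emeasure_eq_measure measure_cylinder measure_pmf_single pmf_pair ennreal_mult)
  qed
  have "emeasure ?M {\<omega>. \<omega> \<in> B (fst \<omega> v) (snd \<omega> v)}
      = (\<integral>\<^sup>+i. emeasure ?M (case i of (j, z) \<Rightarrow> ?C j z \<inter> B j z) \<partial>count_space UNIV)"
    unfolding resampling_decomposition
    by (rule emeasure_UN_countable)
      (use sets in \<open>auto simp: disjoint_family_on_def cylinder_def\<close>)
  also have "\<dots> = (\<integral>\<^sup>+i. ennreal (pmf (pair_pmf ?p ?q) i) * emeasure ?M (B (fst i) (snd i)) \<partial>count_space UNIV)"
    by (intro nn_integral_cong) (auto simp: prob)
  also have "\<dots> = (\<integral>\<^sup>+i. emeasure ?M (B (fst i) (snd i)) \<partial>measure_pmf (pair_pmf ?p ?q))"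
    by (rule nn_integral_measure_pmf[symmetric])
  also have "\<dots> = (\<integral>\<^sup>+i. emeasure ?M (B (snd i) (fst i)) \<partial>measure_pmf (pair_pmf ?q ?p))"
    by (subst pair_commute_pmf) (simp add: case_prod_unfold)
  also have "\<dots> = (\<integral>\<^sup>+z. (\<integral>\<^sup>+j. emeasure ?M (B j z) \<partial>measure_pmf ?p) \<partial>measure_pmf ?q)"
    by (simp add: nn_integral_pair_pmf')
  finally show ?thesis .
qed

section \<open>Escape events of the reversed snake\<close>

text \<open>
  The events that truncated parts of the snake avoid \<open>A\<close>, given recursively so that their
  probabilities satisfy the recursions above. In \<open>branch_avoids\<close> the point \<open>x\<close> is the position of
  the parent of \<open>v\<close>: the edge from the parent belongs to the branch, since its variable is indexed
  by \<open>v\<close>. Likewise \<open>x\<close> in \<open>spine_avoids\<close> is the position of the spine vertex before the \<open>n\<close>-th one,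
  while the position \<open>y\<close> in \<open>bush_avoids\<close> is that of the root of the bush.
\<close>
primrec branch_avoids :: "'a::ab_group_add set \<Rightarrow> nat \<Rightarrow> 'a \<Rightarrow> vertex \<Rightarrow>
    (vertex \<Rightarrow> nat) \<times> (vertex \<Rightarrow> 'a) \<Rightarrow> bool" where
  "branch_avoids A 0 x v \<omega> \<longleftrightarrow> x + snd \<omega> v \<notin> A"
| "branch_avoids A (Suc l) x v \<omega> \<longleftrightarrow> x + snd \<omega> v \<notin> A \<and>
     (\<forall>i<fst \<omega> v. branch_avoids A l (x + snd \<omega> v) (fst v, snd v @ [i]) \<omega>)"

definition bush_avoids :: "'a::ab_group_add set \<Rightarrow> nat \<Rightarrow> 'a \<Rightarrow> nat \<Rightarrow>
    (vertex \<Rightarrow> nat) \<times> (vertex \<Rightarrow> 'a) \<Rightarrow> bool" where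
  "bush_avoids A l y n \<omega> \<longleftrightarrow> y \<notin> A \<and> (\<forall>i<fst \<omega> (n, []). branch_avoids A l y (n, [i]) \<omega>)"

primrec spine_avoids :: "'a::ab_group_add set \<Rightarrow> nat \<Rightarrow> nat \<Rightarrow> 'a \<Rightarrow> nat \<Rightarrow>
    (vertex \<Rightarrow> nat) \<times> (vertex \<Rightarrow> 'a) \<Rightarrow> bool" where
  "spine_avoids A l 0 x n \<omega> \<longleftrightarrow> True"
| "spine_avoids A l (Suc k) x n \<omega> \<longleftrightarrow>
     bush_avoids A l (x + snd \<omega> (n, [])) n \<omega> \<and> spine_avoids A l k (x + snd \<omega> (n, [])) (Suc n) \<omega>"

definition subtree :: "nat \<Rightarrow> nat list \<Rightarrow> vertex set" where
  "subtree m u = {m} \<times> range (\<lambda>w. u @ w)"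

lemma subtree_disjoint: "i \<noteq> j \<Longrightarrow> subtree m (u @ [i]) \<inter> subtree m (u @ [j]) = {}"
  by (auto simp: subtree_def)

lemma subtree_child: "subtree m (u @ [i]) \<subseteq> subtree m u - {(m, u)}"
  by (auto simp: subtree_def)

lemma branch_avoids_region: "{\<omega>. branch_avoids A l x (m, u) \<omega>} \<in> region_events (subtree m u)"
  for x :: "'a::{countable, ab_group_add}"
proof (induction l arbitrary: x u)
  case 0
  let ?B = "\<lambda>(j::nat) z. {\<omega> :: (vertex \<Rightarrow> nat) \<times> (vertex \<Rightarrow> 'a). x + z \<notin> A}"
  have "{\<omega>. \<omega> \<in> ?B (fst \<omega> (m, u)) (snd \<omega> (m, u))} \<in> region_events (subtree m u)"
    by (intro region_events_resample region_events_const) (auto simp: subtree_def)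
  then show ?case by (simp only: mem_Collect_eq branch_avoids.simps)
next
  case (Suc l)
  have "{\<omega>. branch_avoids A l y (m, u @ [i]) \<omega>} \<in> region_events (subtree m u)" for y i
    using Suc region_events_mono[of "subtree m (u @ [i])" "subtree m u"] subtree_child by blast
  then have "{\<omega>. x + z \<notin> A \<and> (\<forall>i<j. branch_avoids A l (x + z) (m, u @ [i]) \<omega>)}
      \<in> region_events (subtree m u)" for j z
    by (intro region_events_conj region_events_const region_events_All_less)
  then have "{\<omega>. \<omega> \<in> (\<lambda>j z. {\<omega>. x + z \<notin> A \<and> (\<forall>i<j. branch_avoids A l (x + z) (m, u @ [i]) \<omega>)})
      (fst \<omega> (m, u)) (snd \<omega> (m, u))} \<in> region_events (subtree m u)"
    by (intro region_events_resample) (auto simp: subtree_def)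
  then show ?case by simp
qed

lemma bush_avoids_region_below:
  "{\<omega>. y \<notin> A \<and> (\<forall>i<j. branch_avoids A l y (n, [i]) \<omega>)} \<in> region_events ({n} \<times> UNIV)"
  for y :: "'a::{countable, ab_group_add}"
proof -
  have "{\<omega>. branch_avoids A l y (n, [i]) \<omega>} \<in> region_events ({n} \<times> UNIV)" for i
    using branch_avoids_region[of A l y n "[i]"]
      region_events_mono[of "subtree n [i]" "{n} \<times> UNIV"] by (auto simp: subtree_def)
  then show ?thesis
    by (intro region_events_conj region_events_const region_events_All_less)
qed

lemma spine_avoids_region: "{\<omega>. spine_avoids A l k x n \<omega>} \<in> region_events ({n..} \<times> UNIV)"
  for x :: "'a::{countable, ab_group_add}"
proof (induction k arbitrary: x n)
  case 0
  show ?case using region_events_const[of True] by simp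
next
  case (Suc k)
  let ?B = "\<lambda>j z. {\<omega>. (x + z \<notin> A \<and> (\<forall>i<j. branch_avoids A l (x + z) (n, [i]) \<omega>)) \<and>
    spine_avoids A l k (x + z) (Suc n) \<omega>}"
  have "?B j z \<in> region_events ({n..} \<times> UNIV)" for j z
    by (intro region_events_conj
        subsetD[OF region_events_mono[of "{n} \<times> UNIV"] bush_avoids_region_below]
        subsetD[OF region_events_mono[of "{Suc n..} \<times> UNIV"] Suc]) auto
  then have "{\<omega>. \<omega> \<in> ?B (fst \<omega> (n, [])) (snd \<omega> (n, []))} \<in> region_events ({n..} \<times> UNIV)"
    by (intro region_events_resample) auto
  then show ?case by (simp add: bush_avoids_def)
qed

lemma nn_integral_pmf_unit:
  fixes f :: "'a \<Rightarrow> real"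
  assumes "\<And>x. 0 \<le> f x \<and> f x \<le> 1"
  shows "(\<integral>\<^sup>+x. ennreal (f x) \<partial>measure_pmf p) = ennreal (measure_pmf.expectation p f)"
  using assms by (intro nn_integral_eq_integral integrable_pmf_unit) auto

lemma ennreal_expectation_power:
  assumes "0 \<le> c" "c \<le> 1"
  shows "(\<integral>\<^sup>+j. ennreal (c ^ j) \<partial>measure_pmf p) = ennreal (gen_fun p c)"
  unfolding gen_fun_def using assms by (intro nn_integral_pmf_unit) (simp add: power_le_one)

text \<open>
  Conditioning on the offspring number \<open>j\<close> and the position of the first vertex leaves \<open>j\<close>
  independent branches in disjoint subtrees. The hypothesis on \<open>u\<close> excludes the roots of bushes,
  where other laws are in force.
\<close>
lemma prob_branch_avoids:
  fixes x :: "int ^ 'd::finite"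
  assumes "u \<noteq> []"
  shows "measure (reversed_snake \<mu> \<theta>) {\<omega>. branch_avoids A l x (m, u) \<omega>}
    = 1 - jump_mean \<theta> (hit \<mu> \<theta> A l) x"
  using assms
proof (induction l arbitrary: x u)
  let ?M = "reversed_snake \<mu> \<theta>"
  interpret prob_space ?M by (rule prob_space_reversed_snake)
  have expect: "(\<integral>\<^sup>+z. ennreal (1 - hit \<mu> \<theta> A l (x + z)) \<partial>measure_pmf \<theta>)
      = ennreal (1 - jump_mean \<theta> (hit \<mu> \<theta> A l) x)" for l and x :: "int ^ 'd"
  proof -
    have "integrable (measure_pmf \<theta>) (\<lambda>z. hit \<mu> \<theta> A l (x + z))"
      by (intro integrable_pmf_unit) (simp add: hit_unit)
    then show ?thesis
      by (subst nn_integral_pmf_unit) (simp_all add: hit_unit jump_mean_def)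
  qed
  {
    case 0
    have "emeasure ?M {\<omega>. \<omega> \<in> (\<lambda>j z. {\<omega>. x + z \<notin> A}) (fst \<omega> (m, u)) (snd \<omega> (m, u))}
      = (\<integral>\<^sup>+z. (\<integral>\<^sup>+j. emeasure ?M {\<omega>. x + z \<notin> A} \<partial>measure_pmf (offspring_law \<mu> (m, u)))
          \<partial>measure_pmf (jump_law \<theta> (m, u)))"
      by (rule emeasure_resample[where V = "{}", OF _ region_events_const]) simp
    also have "\<dots> = (\<integral>\<^sup>+z. ennreal (1 - hit \<mu> \<theta> A 0 (x + z)) \<partial>measure_pmf \<theta>)"
      using 0 emeasure_space_1 by (auto intro!: nn_integral_cong simp: jump_law_def indicator_def)
    finally have "emeasure ?M {\<omega>. branch_avoids A 0 x (m, u) \<omega>}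
        = ennreal (1 - jump_mean \<theta> (hit \<mu> \<theta> A 0) x)"
      by (simp only: mem_Collect_eq branch_avoids.simps expect)
    then show ?case
      using jump_mean_hit_unit[of \<theta> \<mu> \<theta> A 0 x]
      by (simp add: emeasure_eq_measure ennreal_inj del: hit.simps branch_avoids.simps)
  next
    case (Suc l)
    let ?B = "\<lambda>j z. {\<omega>. x + z \<notin> A \<and> (\<forall>i<j. branch_avoids A l (x + z) (m, u @ [i]) \<omega>)}"
    let ?c = "\<lambda>z. 1 - jump_mean \<theta> (hit \<mu> \<theta> A l) (x + z)"
    have region: "?B j z \<in> region_events (\<Union>i. subtree m (u @ [i]))" for j z
    proof -
      have "{\<omega>. branch_avoids A l (x + z) (m, u @ [i]) \<omega>} \<in> region_events (\<Union>i. subtree m (u @ [i]))" for i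
        by (rule subsetD[OF region_events_mono branch_avoids_region]) auto
      then show ?thesis
        by (intro region_events_conj region_events_const region_events_All_less)
    qed
    have B: "emeasure ?M (?B j z) = (if x + z \<in> A then 0 else ennreal (?c z ^ j))" for j z
    proof -
      have "measure ?M {\<omega>. \<forall>i\<in>{..<j}. \<omega> \<in> {\<omega>. branch_avoids A l (x + z) (m, u @ [i]) \<omega>}}
          = (\<Prod>i\<in>{..<j}. measure ?M {\<omega>. branch_avoids A l (x + z) (m, u @ [i]) \<omega>})"
        by (rule prob_disjoint_regions[where V = "\<lambda>i. subtree m (u @ [i])"])
          (auto simp: disjoint_family_on_def subtree_disjoint branch_avoids_region)
      then show ?thesis
        using Suc.IH by (simp add: emeasure_eq_measure Ball_def)
    qed
    have "emeasure ?M {\<omega>. \<omega> \<in> ?B (fst \<omega> (m, u)) (snd \<omega> (m, u))}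
      = (\<integral>\<^sup>+z. (\<integral>\<^sup>+j. emeasure ?M (?B j z) \<partial>measure_pmf (offspring_law \<mu> (m, u)))
          \<partial>measure_pmf (jump_law \<theta> (m, u)))"
      by (rule emeasure_resample[OF _ region]) (auto simp: subtree_def)
    also have "\<dots> = (\<integral>\<^sup>+z. ennreal (1 - hit \<mu> \<theta> A (Suc l) (x + z)) \<partial>measure_pmf \<theta>)"
      unfolding B using Suc.prems
      by (auto intro!: nn_integral_cong
          simp: jump_law_def offspring_law_def jump_mean_hit_unit ennreal_expectation_power)
    finally show ?case
      using jump_mean_hit_unit[of \<theta> \<mu> \<theta> A "Suc l" x] by (simp add: expect emeasure_eq_measure del: hit.simps)
  }
qed

text \<open>
  The same conditioning at a spine vertex. Besides the \<open>j\<close> branches there is the rest of the spine,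
  which is treated as one more independent region.
\<close>
lemma prob_spine_avoids:
  fixes x :: "int ^ 'd::finite"
  shows "measure (reversed_snake \<mu> \<theta>) {\<omega>. spine_avoids A l k x n \<omega>} = spine_miss \<mu> \<theta> A l k x"
proof (induction k arbitrary: x n)
  let ?M = "reversed_snake \<mu> \<theta>"
  interpret prob_space ?M by (rule prob_space_reversed_snake)
  {
    case 0
    show ?case using prob_space by simp
  next
    case (Suc k)
    let ?B = "\<lambda>j z. {\<omega>. (x + z \<notin> A \<and> (\<forall>i<j. branch_avoids A l (x + z) (n, [i]) \<omega>)) \<and>
      spine_avoids A l k (x + z) (Suc n) \<omega>}"
    let ?V = "(\<Union>i. subtree n [i]) \<union> {Suc n..} \<times> UNIV"
    let ?c = "\<lambda>z. 1 - jump_mean \<theta> (hit \<mu> \<theta> A l) (x + z)"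
    let ?e = "\<lambda>z. spine_miss \<mu> \<theta> A l k (x + z)"
    have region: "?B j z \<in> region_events ?V" for j z
    proof -
      have "{\<omega>. branch_avoids A l (x + z) (n, [i]) \<omega>} \<in> region_events ?V" for i
        by (rule subsetD[OF region_events_mono branch_avoids_region]) auto
      then show ?thesis
        by (intro region_events_conj region_events_const region_events_All_less
            subsetD[OF region_events_mono[of "{Suc n..} \<times> UNIV"] spine_avoids_region]) auto
    qed
    have B: "emeasure ?M (?B j z) = (if x + z \<in> A then 0 else ennreal (?c z ^ j) * ennreal (?e z))" for j z
    proof -
      let ?E = "\<lambda>i. {\<omega>. if i < j then branch_avoids A l (x + z) (n, [i]) \<omega>
        else spine_avoids A l k (x + z) (Suc n) \<omega>}"
      have "measure ?M {\<omega>. \<forall>i\<in>{..j}. \<omega> \<in> ?E i} = (\<Prod>i\<in>{..j}. measure ?M (?E i))"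
      proof (rule prob_disjoint_regions[where V = "\<lambda>i. if i < j then subtree n [i] else {Suc n..} \<times> UNIV"])
        show "disjoint_family_on (\<lambda>i. if i < j then subtree n [i] else {Suc n..} \<times> UNIV) {..j}"
          by (auto simp: disjoint_family_on_def subtree_def)
        show "?E i \<in> region_events (if i < j then subtree n [i] else {Suc n..} \<times> UNIV)" for i
          by (simp add: branch_avoids_region spine_avoids_region)
      qed simp
      also have "(\<Prod>i\<in>{..j}. measure ?M (?E i)) = ?c z ^ j * ?e z"
        by (simp add: lessThan_Suc_atMost[symmetric] prob_branch_avoids Suc.IH)
      also have "{\<omega>. \<forall>i\<in>{..j}. \<omega> \<in> ?E i} = {\<omega>. (\<forall>i<j. branch_avoids A l (x + z) (n, [i]) \<omega>) \<and>
          spine_avoids A l k (x + z) (Suc n) \<omega>}"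
        by (auto simp: le_less)
      finally show ?thesis
        by (simp add: emeasure_eq_measure ennreal_mult jump_mean_hit_unit spine_miss_unit)
    qed
    have "emeasure ?M {\<omega>. \<omega> \<in> ?B (fst \<omega> (n, [])) (snd \<omega> (n, []))}
      = (\<integral>\<^sup>+z. (\<integral>\<^sup>+j. emeasure ?M (?B j z) \<partial>measure_pmf (offspring_law \<mu> (n, [])))
          \<partial>measure_pmf (jump_law \<theta> (n, [])))"
      by (rule emeasure_resample[OF _ region]) (auto simp: subtree_def)
    also have "\<dots> = (\<integral>\<^sup>+z. ennreal (bush_miss \<mu> \<theta> A l (x + z) * ?e z) \<partial>measure_pmf (map_pmf uminus \<theta>))"
      unfolding B
      by (auto intro!: nn_integral_cong
          simp: jump_law_def offspring_law_def bush_miss_def nn_integral_multc jump_mean_hit_unit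
            ennreal_expectation_power ennreal_mult gen_fun_unit spine_miss_unit)
    also have "\<dots> = ennreal (spine_miss \<mu> \<theta> A l (Suc k) x)"
      unfolding spine_miss.simps jump_mean_def
      by (intro nn_integral_pmf_unit unit_interval_mult bush_miss_unit spine_miss_unit)
    finally show ?case
      using spine_miss_unit[of \<mu> \<theta> A l "Suc k" x]
      by (simp add: bush_avoids_def emeasure_eq_measure del: spine_miss.simps)
  }
qed

lemma plane_tree_Nil [simp]: "[] \<in> plane_tree N"
  by (simp add: plane_tree_def)

lemma plane_tree_Cons [simp]: "i # w \<in> plane_tree N \<longleftrightarrow> i < N [] \<and> w \<in> plane_tree (\<lambda>w. N (i # w))"
  by (auto simp: plane_tree_def All_less_Suc2)

lemma branch_avoids_iff:
  "branch_avoids A l x (m, u) \<omega> \<longleftrightarrow>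
    (\<forall>w \<in> plane_tree (\<lambda>w. fst \<omega> (m, u @ w)). length w \<le> l \<longrightarrow>
       x + (\<Sum>j\<le>length w. snd \<omega> (m, u @ take j w)) \<notin> A)"
proof (induction l arbitrary: x u)
  case (Suc l)
  let ?P = "\<lambda>w. w \<in> plane_tree (\<lambda>w. fst \<omega> (m, u @ w)) \<longrightarrow> length w \<le> Suc l \<longrightarrow>
       x + (\<Sum>j\<le>length w. snd \<omega> (m, u @ take j w)) \<notin> A"
  have "(\<forall>w. ?P w) \<longleftrightarrow> ?P [] \<and> (\<forall>i w. ?P (i # w))"
    by (metis neq_Nil_conv)
  also have "\<dots> \<longleftrightarrow> branch_avoids A (Suc l) x (m, u) \<omega>"
    by (auto simp: Suc sum.atMost_Suc_shift add.assoc simp del: sum.atMost_Suc)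
  finally show ?case by blast
qed simp

lemma bush_avoids_iff:
  "bush_avoids A l y n \<omega> \<longleftrightarrow>
    (\<forall>w \<in> plane_tree (\<lambda>w. fst \<omega> (n, w)). length w \<le> Suc l \<longrightarrow>
       y + (\<Sum>j=1..length w. snd \<omega> (n, take j w)) \<notin> A)"
proof -
  let ?P = "\<lambda>w. w \<in> plane_tree (\<lambda>w. fst \<omega> (n, w)) \<longrightarrow> length w \<le> Suc l \<longrightarrow>
       y + (\<Sum>j=1..length w. snd \<omega> (n, take j w)) \<notin> A"
  have "(\<forall>w. ?P w) \<longleftrightarrow> ?P [] \<and> (\<forall>i w. ?P (i # w))"
    by (metis neq_Nil_conv)
  also have "\<dots> \<longleftrightarrow> bush_avoids A l y n \<omega>"
    by (auto simp: bush_avoids_def branch_avoids_iff sum.atLeast1_atMost_eq lessThan_Suc_atMost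
        simp del: sum.atMost_Suc sum.lessThan_Suc sum.cl_ivl_Suc)
  finally show ?thesis by blast
qed

lemma spine_avoids_iff:
  "spine_avoids A l k x n \<omega> \<longleftrightarrow>
    (\<forall>m<k. bush_avoids A l (x + (\<Sum>i\<le>m. snd \<omega> (n + i, []))) (n + m) \<omega>)"
  by (induction k arbitrary: x n)
    (auto simp: All_less_Suc2 sum.atMost_Suc_shift add.assoc simp del: sum.atMost_Suc)

lemma spine_avoids_antimono:
  "l \<le> l' \<Longrightarrow> k \<le> k' \<Longrightarrow> spine_avoids A l' k' x n \<omega> \<Longrightarrow> spine_avoids A l k x n \<omega>"
  unfolding spine_avoids_iff bush_avoids_iff by force

text \<open>
  Height and number of bushes are truncated by the same parameter \<open>n\<close>, so that the escape event is
  the limit of a single decreasing sequence.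
\<close>
lemma avoids_iff:
  "(\<forall>v \<in> infinite_tree N - bush N 0. position x X v \<notin> A) \<longleftrightarrow> (\<forall>n. spine_avoids A n n x 1 (N, X))"
proof -
  have pos: "position x X (Suc m, w)
      = x + (\<Sum>i\<le>m. X (Suc i, [])) + (\<Sum>j=1..length w. X (Suc m, take j w))" for m w
    by (simp add: position_def sum.atLeast1_atMost_eq lessThan_Suc_atMost del: sum.atMost_Suc sum.lessThan_Suc sum.cl_ivl_Suc)
  have "(\<forall>v \<in> infinite_tree N - bush N 0. position x X v \<notin> A) \<longleftrightarrow>
      (\<forall>m. \<forall>w \<in> plane_tree (\<lambda>w. N (Suc m, w)). position x X (Suc m, w) \<notin> A)"
    by (auto simp: infinite_tree_def bush_def) (metis not0_implies_Suc)+
  also have "\<dots> \<longleftrightarrow> (\<forall>n. spine_avoids A n n x 1 (N, X))" (is "?L = ?R")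
  proof
    assume ?L
    then show ?R by (simp add: spine_avoids_iff bush_avoids_iff pos)
  next
    assume R: ?R
    show ?L
    proof (intro allI ballI)
      fix m w assume "w \<in> plane_tree (\<lambda>w. N (Suc m, w))"
      then show "position x X (Suc m, w) \<notin> A"
        using R[rule_format, of "Suc (m + length w)"] by (auto simp: spine_avoids_iff bush_avoids_iff pos)
    qed
  qed
  finally show ?thesis .
qed

lemma Es_altdef: "Es \<mu> \<theta> A x = measure (reversed_snake \<mu> \<theta>) {\<omega>. \<forall>n. spine_avoids A n n x 1 \<omega>}"
  unfolding Es_def by (simp add: avoids_iff case_prod_unfold)

lemma Es_le_spine_miss: "Es \<mu> \<theta> A x \<le> spine_miss \<mu> \<theta> A l k x"
proof -
  interpret prob_space "reversed_snake \<mu> \<theta>" by (rule prob_space_reversed_snake)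
  have "prob {\<omega>. \<forall>n. spine_avoids A n n x 1 \<omega>} \<le> prob {\<omega>. spine_avoids A l k x 1 \<omega>}"
    by (intro finite_measure_mono region_events_sets[OF spine_avoids_region])
      (auto intro: spine_avoids_antimono[of l "max l k" k "max l k"])
  then show ?thesis by (simp add: Es_altdef prob_spine_avoids)
qed

lemma spine_miss_tendsto_Es: "(\<lambda>n. spine_miss \<mu> \<theta> A n n x) \<longlonglongrightarrow> Es \<mu> \<theta> A x"
proof -
  interpret prob_space "reversed_snake \<mu> \<theta>" by (rule prob_space_reversed_snake)
  let ?E = "\<lambda>n. {\<omega>. spine_avoids A n n x 1 \<omega>}"
  have "(\<lambda>n. prob (?E n)) \<longlonglongrightarrow> prob (\<Inter>n. ?E n)"
    by (intro finite_Lim_measure_decseq)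
      (auto simp: decseq_def region_events_sets[OF spine_avoids_region] intro: spine_avoids_antimono)
  also have "(\<Inter>n. ?E n) = {\<omega>. \<forall>n. spine_avoids A n n x 1 \<omega>}" by auto
  finally show ?thesis by (simp add: Es_altdef prob_spine_avoids)
qed

section \<open>Comparison of branching capacities\<close>

lemma BCap_comparison:
  assumes "critical \<mu>1" "finite_second_moment \<mu>1" "critical \<mu>2" "nondegenerate \<mu>2"
  obtains K where "1 \<le> K"
    "\<And>(\<theta> :: (int ^ 'd::finite) pmf) A. finite A \<Longrightarrow> BCap \<mu>2 \<theta> A \<le> K * BCap \<mu>1 \<theta> A"
proof -
  obtain K where K: "1 \<le> K"
    "\<And>s t. \<lbrakk>0 \<le> s; s \<le> 1; 0 \<le> t; t \<le> 1; t \<le> K * s\<rbrakk> \<Longrightarrow>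
       1 - gen_fun \<mu>2 (1 - t) \<le> K * (1 - gen_fun \<mu>1 (1 - s))"
    using gen_fun_comparison[OF assms] by blast
  have "BCap \<mu>2 \<theta> A \<le> K * BCap \<mu>1 \<theta> A" if "finite A" for \<theta> :: "(int ^ 'd) pmf" and A
    unfolding BCap_def
    by (rule escape_sum_comparison[OF K assms(1,3) that spine_miss_tendsto_Es Es_le_spine_miss])
  with K(1) show ?thesis by (rule that)
qed

theorem theorem1p5:
  fixes \<mu>1 \<mu>2 :: "nat pmf"
  assumes "CARD('d::finite) \<ge> 5"
    and "critical \<mu>1" "nondegenerate \<mu>1" "finite_second_moment \<mu>1"
    and "critical \<mu>2" "nondegenerate \<mu>2" "finite_second_moment \<mu>2"
  shows "\<exists>C::real. C > 0 \<and>
    (\<forall>\<theta> :: (int ^ 'd) pmf. jump_distribution \<theta> \<longrightarrow>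
      (\<forall>A. finite A \<longrightarrow>
        inverse C * BCap \<mu>1 \<theta> A \<le> BCap \<mu>2 \<theta> A \<and>
        BCap \<mu>2 \<theta> A \<le> C * BCap \<mu>1 \<theta> A))"
proof -
  obtain K where K: "1 \<le> K"
    "\<And>(\<theta> :: (int ^ 'd) pmf) A. finite A \<Longrightarrow> BCap \<mu>2 \<theta> A \<le> K * BCap \<mu>1 \<theta> A"
    using BCap_comparison[of \<mu>1 \<mu>2] assms by metis
  obtain L where L: "1 \<le> L"
    "\<And>(\<theta> :: (int ^ 'd) pmf) A. finite A \<Longrightarrow> BCap \<mu>1 \<theta> A \<le> L * BCap \<mu>2 \<theta> A"
    using BCap_comparison[of \<mu>2 \<mu>1] assms by metis
  have nonneg: "0 \<le> BCap \<mu> \<theta> A" for \<mu> and \<theta> :: "(int ^ 'd) pmf" and A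
    by (simp add: BCap_def Es_def sum_nonneg)
  show ?thesis
  proof (intro exI[of _ "max K L"] conjI allI impI)
    show "0 < max K L" using K(1) by simp
    fix \<theta> :: "(int ^ 'd) pmf" and A :: "(int ^ 'd) set" assume A: "finite A"
    have "BCap \<mu>1 \<theta> A \<le> max K L * BCap \<mu>2 \<theta> A"
      by (rule order_trans[OF L(2)[OF A]]) (intro mult_right_mono nonneg, simp)
    then show "inverse (max K L) * BCap \<mu>1 \<theta> A \<le> BCap \<mu>2 \<theta> A"
      using K(1) by (simp add: inverse_eq_divide pos_divide_le_eq mult.commute)
    show "BCap \<mu>2 \<theta> A \<le> max K L * BCap \<mu>1 \<theta> A"
      by (rule order_trans[OF K(2)[OF A]]) (intro mult_right_mono nonneg, simp)
  qed
qed

end
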